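(* Let $\psi$ be a homomorphism and $B$ a stochastic inverse of $\psi$. Let $|V^*(h)-V^*(h')|\le\varepsilon$ for all $\psi(h)=\psi(h')$, and $\left|\sum_{\tilde a\in\mathcal A}Q^*(h,\tilde a)B^{\pi^*}(\tilde a|hs)-V^*(h)\right|\le\varepsilon_B$ for all $s=\psi(h)$. Then for all $h\in\mathcal H$, $a\in\mathcal A$ and $(s,b)=\psi(h,a)$: (i) $\left|\langle Q^*(\psi^{-1}(s,b))\rangle_B-q^*(s,b)\right|\le\frac{3\gamma(\varepsilon+\varepsilon_B)}{(1-\gamma)^2}$ and $|V^*(h)-v^*(s)|\le\frac{3(\varepsilon+\varepsilon_B)}{(1-\gamma)^2}$. (ii) If $\varepsilon+\varepsilon_B=0$ then $\psi(h,\Pi^*(h))=(s,\pi^*(s))$ for all $\psi(h)=s$.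
   Context: Setting. $\mathcal A$ (actions), $\mathcal O$ (observations), $\mathcal R\subseteq[0,1]$ (rewards) are finite sets; $\gamma\in[0,1)$; $\Delta(X)$ is the set of probability distributions on $X$. $\mathcal H:=\bigcup_{t\ge0}(\mathcal A\times\mathcal O\times\mathcal R)^t$ is the set of histories. The original process is a map $P:\mathcal H\times\mathcal A\to\Delta(\mathcal O\times\mathcal R)$, written $P(or|ha)$ (arbitrary dependence on the history). A policy is a map $\Pi:\mathcal H\to\Delta(\mathcal A)$. Its (action-)value functions are given by $Q^\Pi(h,a)=\sum_{o,r}P(or|ha)\,(r+\gamma V^\Pi(haor))$ and $V^\Pi(h)=\sum_{a}Q^\Pi(h,a)\Pi(a|h)$, where $haor$ is the history $h$ extended by $(a,o,r)$. $\Pi^*$ is an optimal policy (a maximizer of $V^\Pi$), taken deterministic when written as $\Pi^*(h)\in\mathcal A$; $Q^*,V^*$ are its (action-)value functions, so $V^*(h)=\max_aQ^*(h,a)$. Homomorphism. $\mathcal S$ and $\mathcal B$ are finite sets (abstract states and abstract actions). A homomorphism is a surjective map $\psi:\mathcal H\times\mathcal A\to\mathcal S\times\mathcal B$ whose state component depends only on the history: $\psi(h,a)=(f(h),b)$ for a fixed surjective $f:\mathcal H\to\mathcal S$ (while $b$ may depend on both $h$ and $a$). Write $\psi(h)=s$ for $f(h)=s$. The induced abstract process is $P_\psi(s'r|ha):=\sum_{o:\psi(haor)=s'}P(or|ha)$. Stochastic inverse. A stochastic inverse of $\psi$ is a map $B:\mathcal S\times\mathcal B\to\Delta(\mathcal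 H\times\mathcal A)$, written $B(ha|sb)$, with $B(ha|sb)=0$ whenever $\psi(h,a)\neq(s,b)$. By abuse of notation, $B$ also denotes a joint distribution over $\mathcal H,\mathcal A,\mathcal S,\mathcal B$ with this conditional, together with its marginals and conditionals; since the state is determined by the history, $B(ha|sb)=B(h|s)\,\frac{B(ab|h)}{B(b|s)}$. For an abstract policy $\pi:\mathcal S\to\Delta(\mathcal B)$ define $B^\pi(a|hs):=\sum_{b\in\mathcal B}\frac{B(ab|h)}{B(b|s)}\pi(b|s)$. The $B$-average is $\langle Q^*(\psi^{-1}(s,b))\rangle_B:=\sum_{h\in\mathcal H,a\in\mathcal A}Q^*(h,a)B(ha|sb)$. Surrogate MDP. $p_B(s'r'|sb):=\sum_{h\in\mathcal H,a\in\mathcal A}P_\psi(s'r'|ha)B(ha|sb)$. For an abstract policy $\pi$, $q^\pi,v^\pi$ are given by $q^\pi(s,b)=\sum_{s',r}p_B(s'r|sb)(r+\gamma v^\pi(s'))$, $v^\pi(s)=\sum_bq^\pi(s,b)\pi(b|s)$. $\pi^*$ is an optimal abstract policy (a maximizer of $v^\pi$), taken deterministic when written as $\pi^*(s)\in\mathcal B$; $q^*,v^*$ are its (action-)value functions.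
   Formalization: In (ii), false as stated (ties; no action mapped to π*(s)), Π* is a suitable optimal policy for the given π* (any optimal Π* where Q*(h,·) has a unique maximizer), and h needs B(h)>0 and either V*(h)≠0 or some a with ψ(h,a)=(s,π*(s)). *)

theory Defs
  imports "HOL-Probability.Probability"
begin

section \<open>Histories, policies and value functions of the original process\<close>

text \<open>The finite sets of actions and observations are finite types; the rewards form a finite set
  of reals.  A step \<open>(a, o, r)\<close> extends a history at the end of the list.\<close>

type_synonym ('a, 'o) history = "('a \<times> 'o \<times> real) list"

definition histories :: "real set \<Rightarrow> ('a, 'o) history set" where
  "histories R = lists (UNIV \<times> UNIV \<times> R)"

definition process :: "real set \<Rightarrow> (('a, 'o) history \<Rightarrow> 'a \<Rightarrow> ('o \<times> real) pmf) \<Rightarrow> bool" where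
  "process R P \<longleftrightarrow> (\<forall>h \<in> histories R. \<forall>a. set_pmf (P h a) \<subseteq> UNIV \<times> R)"

definition backup ::
  "real set \<Rightarrow> (('a, 'o::finite) history \<Rightarrow> 'a \<Rightarrow> ('o \<times> real) pmf) \<Rightarrow> real
    \<Rightarrow> (('a, 'o) history \<Rightarrow> real) \<Rightarrow> ('a, 'o) history \<Rightarrow> 'a \<Rightarrow> real" where
  "backup R P \<gamma> V h a = (\<Sum>x\<in>UNIV. \<Sum>r\<in>R. pmf (P h a) (x, r) * (r + \<gamma> * V (h @ [(a, x, r)])))"

text \<open>The recursive equations determine \<open>V\<close> on histories only among bounded functions; the value
  outside the set of histories is irrelevant and fixed to be \<open>0\<close>.\<close>

definition is_value ::
  "real set \<Rightarrow> (('a::finite, 'o::finite) history \<Rightarrow> 'a \<Rightarrow> ('o \<times> real) pmf) \<Rightarrow> real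
    \<Rightarrow> (('a, 'o) history \<Rightarrow> 'a pmf) \<Rightarrow> (('a, 'o) history \<Rightarrow> real) \<Rightarrow> bool" where
  "is_value R P \<gamma> \<Phi> V \<longleftrightarrow>
     bounded (V ` histories R) \<and>
     (\<forall>h \<in> histories R. V h = (\<Sum>a\<in>UNIV. backup R P \<gamma> V h a * pmf (\<Phi> h) a)) \<and>
     (\<forall>h. h \<notin> histories R \<longrightarrow> V h = 0)"

definition V_value ::
  "real set \<Rightarrow> (('a::finite, 'o::finite) history \<Rightarrow> 'a \<Rightarrow> ('o \<times> real) pmf) \<Rightarrow> real
    \<Rightarrow> (('a, 'o) history \<Rightarrow> 'a pmf) \<Rightarrow> ('a, 'o) history \<Rightarrow> real" where
  "V_value R P \<gamma> \<Phi> = (THE V. is_value R P \<gamma> \<Phi> V)"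

definition Q_value ::
  "real set \<Rightarrow> (('a::finite, 'o::finite) history \<Rightarrow> 'a \<Rightarrow> ('o \<times> real) pmf) \<Rightarrow> real
    \<Rightarrow> (('a, 'o) history \<Rightarrow> 'a pmf) \<Rightarrow> ('a, 'o) history \<Rightarrow> 'a \<Rightarrow> real" where
  "Q_value R P \<gamma> \<Phi> = backup R P \<gamma> (V_value R P \<gamma> \<Phi>)"

definition optimal_policy ::
  "real set \<Rightarrow> (('a::finite, 'o::finite) history \<Rightarrow> 'a \<Rightarrow> ('o \<times> real) pmf) \<Rightarrow> real
    \<Rightarrow> (('a, 'o) history \<Rightarrow> 'a pmf) \<Rightarrow> bool" where
  "optimal_policy R P \<gamma> \<Phi> \<longleftrightarrow>
     (\<forall>\<Phi>'. \<forall>h \<in> histories R. V_value R P \<gamma> \<Phi>' h \<le> V_value R P \<gamma> \<Phi> h)"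

definition deterministic :: "('x \<Rightarrow> 'y) \<Rightarrow> 'x \<Rightarrow> 'y pmf" where
  "deterministic g = (\<lambda>x. return_pmf (g x))"


section \<open>Homomorphisms and stochastic inverses\<close>

definition homomorphism ::
  "real set \<Rightarrow> (('a, 'o) history \<times> 'a \<Rightarrow> 's \<times> 'b) \<Rightarrow> (('a, 'o) history \<Rightarrow> 's) \<Rightarrow> bool" where
  "homomorphism R \<psi> f \<longleftrightarrow>
     (\<forall>h \<in> histories R. \<forall>a. fst (\<psi> (h, a)) = f h) \<and>
     f ` histories R = UNIV \<and>
     \<psi> ` (histories R \<times> UNIV) = UNIV"

definition P_abs ::
  "(('a, 'o::finite) history \<Rightarrow> 'a \<Rightarrow> ('o \<times> real) pmf) \<Rightarrow> (('a, 'o) history \<Rightarrow> 's)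
    \<Rightarrow> ('a, 'o) history \<Rightarrow> 'a \<Rightarrow> 's \<Rightarrow> real \<Rightarrow> real" where
  "P_abs P f h a s' r = (\<Sum>x \<in> {x. f (h @ [(a, x, r)]) = s'}. pmf (P h a) (x, r))"

definition stochastic_inverse ::
  "real set \<Rightarrow> (('a, 'o) history \<times> 'a \<Rightarrow> 's \<times> 'b)
    \<Rightarrow> ('s \<Rightarrow> 'b \<Rightarrow> (('a, 'o) history \<times> 'a) pmf) \<Rightarrow> bool" where
  "stochastic_inverse R \<psi> B \<longleftrightarrow>
     (\<forall>s b. set_pmf (B s b) \<subseteq> {(h, a). h \<in> histories R \<and> \<psi> (h, a) = (s, b)})"

text \<open>A joint distribution \<open>J\<close> on histories, actions, abstract states and abstract actions whose
  conditional distribution given \<open>(s, b)\<close> exists and is \<open>B s b\<close>.\<close>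

definition joint_of ::
  "('s \<Rightarrow> 'b \<Rightarrow> (('a, 'o) history \<times> 'a) pmf) \<Rightarrow> (('a, 'o) history \<times> 'a \<times> 's \<times> 'b) pmf \<Rightarrow> bool" where
  "joint_of B J \<longleftrightarrow>
     (\<forall>s b. \<P>((h, a, s', b') in measure_pmf J. s' = s \<and> b' = b) > 0 \<and>
       (\<forall>h a. \<P>((h', a', s', b') in measure_pmf J. h' = h \<and> a' = a \<bar> s' = s \<and> b' = b)
              = pmf (B s b) (h, a)))"

definition J_h :: "('h \<times> 'a \<times> 's \<times> 'b) pmf \<Rightarrow> 'h \<Rightarrow> real" where
  "J_h J h = \<P>((h', a, s, b) in measure_pmf J. h' = h)"

definition J_h_s :: "('h \<times> 'a \<times> 's \<times> 'b) pmf \<Rightarrow> 'h \<Rightarrow> 's \<Rightarrow> real" where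
  "J_h_s J h s = \<P>((h', a, s', b) in measure_pmf J. h' = h \<bar> s' = s)"

definition J_b_s :: "('h \<times> 'a \<times> 's \<times> 'b) pmf \<Rightarrow> 'b \<Rightarrow> 's \<Rightarrow> real" where
  "J_b_s J b s = \<P>((h, a, s', b') in measure_pmf J. b' = b \<bar> s' = s)"

definition J_ab_h :: "('h \<times> 'a \<times> 's \<times> 'b) pmf \<Rightarrow> 'a \<Rightarrow> 'b \<Rightarrow> 'h \<Rightarrow> real" where
  "J_ab_h J a b h = \<P>((h', a', s, b') in measure_pmf J. a' = a \<and> b' = b \<bar> h' = h)"

text \<open>The weights \<open>B\<^sup>\<pi>(a|hs)\<close>; they are meaningful only if \<open>J_h J h > 0\<close>, and they need not
  sum to \<open>1\<close> over \<open>a\<close>.\<close>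

definition lifted_policy ::
  "('h \<times> 'a \<times> 's \<times> 'b::finite) pmf \<Rightarrow> ('s \<Rightarrow> 'b pmf) \<Rightarrow> 'a \<Rightarrow> 'h \<Rightarrow> 's \<Rightarrow> real" where
  "lifted_policy J \<pi> a h s = (\<Sum>b\<in>UNIV. J_ab_h J a b h / J_b_s J b s * pmf (\<pi> s) b)"

definition B_average ::
  "real set \<Rightarrow> ('s \<Rightarrow> 'b \<Rightarrow> (('a, 'o) history \<times> 'a) pmf)
    \<Rightarrow> (('a, 'o) history \<Rightarrow> 'a \<Rightarrow> real) \<Rightarrow> 's \<Rightarrow> 'b \<Rightarrow> real" where
  "B_average R B Q s b = (\<Sum>\<^sub>\<infinity>(h, a) \<in> histories R \<times> UNIV. Q h a * pmf (B s b) (h, a))"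


section \<open>The surrogate MDP\<close>

definition p_surr ::
  "real set \<Rightarrow> (('a, 'o::finite) history \<Rightarrow> 'a \<Rightarrow> ('o \<times> real) pmf) \<Rightarrow> (('a, 'o) history \<Rightarrow> 's)
    \<Rightarrow> ('s \<Rightarrow> 'b \<Rightarrow> (('a, 'o) history \<times> 'a) pmf) \<Rightarrow> 's \<Rightarrow> 'b \<Rightarrow> 's \<Rightarrow> real \<Rightarrow> real" where
  "p_surr R P f B s b s' r =
     (\<Sum>\<^sub>\<infinity>(h, a) \<in> histories R \<times> UNIV. P_abs P f h a s' r * pmf (B s b) (h, a))"

definition mdp_backup ::
  "real set \<Rightarrow> ('s::finite \<Rightarrow> 'b \<Rightarrow> 's \<Rightarrow> real \<Rightarrow> real) \<Rightarrow> real \<Rightarrow> ('s \<Rightarrow> real) \<Rightarrow> 's \<Rightarrow> 'b \<Rightarrow> real" where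
  "mdp_backup R p \<gamma> v s b = (\<Sum>s'\<in>UNIV. \<Sum>r\<in>R. p s b s' r * (r + \<gamma> * v s'))"

definition is_mdp_value ::
  "real set \<Rightarrow> ('s::finite \<Rightarrow> 'b::finite \<Rightarrow> 's \<Rightarrow> real \<Rightarrow> real) \<Rightarrow> real \<Rightarrow> ('s \<Rightarrow> 'b pmf)
    \<Rightarrow> ('s \<Rightarrow> real) \<Rightarrow> bool" where
  "is_mdp_value R p \<gamma> \<pi> v \<longleftrightarrow> (\<forall>s. v s = (\<Sum>b\<in>UNIV. mdp_backup R p \<gamma> v s b * pmf (\<pi> s) b))"

definition v_value ::
  "real set \<Rightarrow> ('s::finite \<Rightarrow> 'b::finite \<Rightarrow> 's \<Rightarrow> real \<Rightarrow> real) \<Rightarrow> real \<Rightarrow> ('s \<Rightarrow> 'b pmf)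
    \<Rightarrow> 's \<Rightarrow> real" where
  "v_value R p \<gamma> \<pi> = (THE v. is_mdp_value R p \<gamma> \<pi> v)"

definition q_value ::
  "real set \<Rightarrow> ('s::finite \<Rightarrow> 'b::finite \<Rightarrow> 's \<Rightarrow> real \<Rightarrow> real) \<Rightarrow> real \<Rightarrow> ('s \<Rightarrow> 'b pmf)
    \<Rightarrow> 's \<Rightarrow> 'b \<Rightarrow> real" where
  "q_value R p \<gamma> \<pi> = mdp_backup R p \<gamma> (v_value R p \<gamma> \<pi>)"

definition optimal_mdp_policy ::
  "real set \<Rightarrow> ('s::finite \<Rightarrow> 'b::finite \<Rightarrow> 's \<Rightarrow> real \<Rightarrow> real) \<Rightarrow> real \<Rightarrow> ('s \<Rightarrow> 'b pmf) \<Rightarrow> bool" where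
  "optimal_mdp_policy R p \<gamma> \<pi> \<longleftrightarrow> (\<forall>\<pi>' s. v_value R p \<gamma> \<pi>' s \<le> v_value R p \<gamma> \<pi> s)"


section \<open>Well-posedness of the definitions\<close>

lemma contraction_unique_bounded_fixpoint:
  fixes T :: "('x \<Rightarrow> real) \<Rightarrow> 'x \<Rightarrow> real"
  assumes \<gamma>: "0 \<le> \<gamma>" "\<gamma> < 1"
    and contr: "\<And>V W c x. (\<And>y. \<bar>V y - W y\<bar> \<le> c) \<Longrightarrow> \<bar>T V x - T W x\<bar> \<le> \<gamma> * c"
    and bd: "\<And>x. \<bar>T (\<lambda>_. 0) x\<bar> \<le> M"
  shows "\<exists>!V. bounded (range V) \<and> (\<forall>x. V x = T V x)"
proof (rule ex_ex1I)
  define u where "u n = (T ^^ n) (\<lambda>_. 0)" for n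
  have step: "\<bar>u (Suc n) x - u n x\<bar> \<le> \<gamma> ^ n * M" for n x
  proof (induction n arbitrary: x)
    case 0 then show ?case using bd by (simp add: u_def)
  next
    case (Suc n)
    have "\<bar>T (u (Suc n)) x - T (u n) x\<bar> \<le> \<gamma> * (\<gamma> ^ n * M)"
      by (rule contr) (rule Suc)
    then show ?case by (simp add: u_def mult.assoc)
  qed
  have M0: "0 \<le> M" using bd[of undefined] by linarith
  have sumg: "summable (\<lambda>n. \<gamma> ^ n * M)"
    using \<gamma> by (intro summable_mult2 summable_geometric) auto
  have sumd: "summable (\<lambda>n. \<bar>u (Suc n) x - u n x\<bar>)" for x
    by (rule summable_comparison_test'[OF sumg, of 0]) (use step in auto)
  define V where "V x = (\<Sum>n. u (Suc n) x - u n x)" for x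
  have Vlim: "(\<lambda>n. u n x) \<longlonglongrightarrow> V x" for x
  proof -
    have "summable (\<lambda>n. u (Suc n) x - u n x)" by (rule summable_rabs_cancel[OF sumd])
    then have "(\<lambda>n. \<Sum>i<n. u (Suc i) x - u i x) \<longlonglongrightarrow> V x"
      unfolding V_def by (rule summable_LIMSEQ)
    moreover have "(\<Sum>i<n. u (Suc i) x - u i x) = u n x" for n
      by (subst sum_lessThan_telescope) (simp add: u_def)
    ultimately show ?thesis by simp
  qed
  have near: "\<bar>V x - u n x\<bar> \<le> \<gamma> ^ n * (M / (1 - \<gamma>))" for n x
  proof -
    have part: "\<bar>u (n + k) x - u n x\<bar> \<le> \<gamma> ^ n * M * (\<Sum>i<k. \<gamma> ^ i)" for k
    proof (induction k)
      case (Suc k)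
      have "\<bar>u (n + Suc k) x - u n x\<bar> \<le> \<bar>u (Suc (n + k)) x - u (n + k) x\<bar> + \<bar>u (n + k) x - u n x\<bar>"
        by simp
      also have "\<dots> \<le> \<gamma> ^ (n + k) * M + \<gamma> ^ n * M * (\<Sum>i<k. \<gamma> ^ i)"
        by (intro add_mono step Suc)
      finally show ?case by (simp add: algebra_simps power_add)
    qed simp
    have geo: "(\<Sum>i<k. \<gamma> ^ i) \<le> 1 / (1 - \<gamma>)" for k
    proof -
      have "(\<Sum>i<k. \<gamma> ^ i) \<le> (\<Sum>i. \<gamma> ^ i)"
        by (rule sum_le_suminf) (use \<gamma> in \<open>auto intro: summable_geometric\<close>)
      then show ?thesis using \<gamma> by (simp add: suminf_geometric)
    qed
    have "\<bar>u (n + k) x - u n x\<bar> \<le> \<gamma> ^ n * (M / (1 - \<gamma>))" for k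
    proof -
      have "\<gamma> ^ n * M * (\<Sum>i<k. \<gamma> ^ i) \<le> \<gamma> ^ n * M * (1 / (1 - \<gamma>))"
        by (intro mult_left_mono geo) (use \<gamma> M0 in auto)
      then show ?thesis using part[of k] by simp
    qed
    moreover have "(\<lambda>k. \<bar>u (n + k) x - u n x\<bar>) \<longlonglongrightarrow> \<bar>V x - u n x\<bar>"
    proof -
      have "(\<lambda>k. u (k + n) x) \<longlonglongrightarrow> V x" using Vlim LIMSEQ_ignore_initial_segment by blast
      then show ?thesis by (intro tendsto_intros) (simp add: add.commute)
    qed
    ultimately show ?thesis by (intro LIMSEQ_le_const2) auto
  qed
  have fix_pt: "V x = T V x" for x
  proof -
    have le: "\<bar>T V x - V x\<bar> \<le> \<gamma> ^ Suc n * (2 * (M / (1 - \<gamma>)))" for n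
    proof -
      let ?K = "\<gamma> ^ Suc n * (M / (1 - \<gamma>))"
      have "\<bar>T V x - T (u n) x\<bar> \<le> \<gamma> * (\<gamma> ^ n * (M / (1 - \<gamma>)))"
        by (rule contr) (rule near)
      then have "\<bar>T V x - u (Suc n) x\<bar> \<le> ?K" by (simp add: u_def mult.assoc)
      then have "\<bar>T V x - V x\<bar> \<le> 2 * ?K" using near[of x "Suc n"] by linarith
      then show ?thesis by (simp only: mult.left_commute)
    qed
    have "(\<lambda>n. \<gamma> ^ Suc n * (2 * (M / (1 - \<gamma>)))) \<longlonglongrightarrow> 0 * (2 * (M / (1 - \<gamma>)))"
      by (intro tendsto_intros LIMSEQ_Suc LIMSEQ_power_zero) (use \<gamma> in auto)
    then have "\<bar>T V x - V x\<bar> \<le> 0"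
      by (intro LIMSEQ_le_const[where X = "\<lambda>n. \<gamma> ^ Suc n * (2 * (M / (1 - \<gamma>)))"]) (use le in auto)
    then show ?thesis by simp
  qed
  have "bounded (range V)"
    using near[of _ 0] by (auto simp: bounded_iff u_def intro!: exI[of _ "M / (1 - \<gamma>)"])
  with fix_pt show "\<exists>V. bounded (range V) \<and> (\<forall>x. V x = T V x)" by blast
next
  fix V W
  assume V: "bounded (range V) \<and> (\<forall>x. V x = T V x)"
    and W: "bounded (range W) \<and> (\<forall>x. W x = T W x)"
  obtain a b where ab: "\<And>x. \<bar>V x\<bar> \<le> a" "\<And>x. \<bar>W x\<bar> \<le> b"
    using conjunct1[OF V] conjunct1[OF W] unfolding bounded_iff by (metis rangeI real_norm_def)
  have "\<bar>V x - W x\<bar> \<le> \<gamma> ^ n * (a + b)" for n x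
  proof (induction n arbitrary: x)
    case 0 show ?case using ab[of x] by simp
  next
    case (Suc n)
    have "\<bar>T V x - T W x\<bar> \<le> \<gamma> * (\<gamma> ^ n * (a + b))" by (rule contr) (rule Suc)
    then show ?case using V W by (simp add: mult.assoc)
  qed
  moreover have "(\<lambda>n. \<gamma> ^ n * (a + b)) \<longlonglongrightarrow> 0 * (a + b)"
    by (intro tendsto_intros LIMSEQ_power_zero) (use \<gamma> in auto)
  ultimately have "\<bar>V x - W x\<bar> \<le> 0" for x
    by (intro LIMSEQ_le_const[where X = "\<lambda>n. \<gamma> ^ n * (a + b)"]) auto
  then show "V = W" by (simp add: fun_eq_iff)
qed

lemma weighted_sum_le:
  fixes w g :: "'i \<Rightarrow> real"
  assumes "\<And>i. i \<in> A \<Longrightarrow> 0 \<le> w i" "sum w A \<le> 1" "\<And>i. i \<in> A \<Longrightarrow> \<bar>g i\<bar> \<le> c" "0 \<le> c"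
  shows "\<bar>\<Sum>i\<in>A. w i * g i\<bar> \<le> c"
proof -
  have "\<bar>\<Sum>i\<in>A. w i * g i\<bar> \<le> (\<Sum>i\<in>A. w i * c)"
    by (rule order_trans[OF sum_abs], rule sum_mono)
      (use assms in \<open>auto simp: abs_mult intro!: mult_left_mono\<close>)
  also have "\<dots> = sum w A * c" by (simp add: sum_distrib_right)
  also have "\<dots> \<le> 1 * c" by (rule mult_right_mono) (use assms in auto)
  finally show ?thesis by simp
qed

lemma sum_process_le_1: "finite R \<Longrightarrow> (\<Sum>x\<in>(UNIV::'o::finite set). \<Sum>r\<in>R. pmf q (x, r)) \<le> 1"
  by (simp add: sum.cartesian_product sum_pmf_eq_1 measure_pmf.prob_le_1 
      flip: measure_measure_pmf_finite)

lemma backup_bound: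
  assumes "finite R" "0 \<le> c" "\<And>x r. r \<in> R \<Longrightarrow> \<bar>r + \<gamma> * V (h @ [(a, x, r)])\<bar> \<le> c"
  shows "\<bar>backup R P \<gamma> V h a\<bar> \<le> c"
  unfolding backup_def sum.cartesian_product case_prod_unfold
  by (rule weighted_sum_le)
    (use assms sum_process_le_1[of R "P h a"]
      in \<open>auto simp: sum.cartesian_product case_prod_unfold\<close>)

lemma backup_diff_bound:
  assumes "finite R" "0 \<le> \<gamma>" "0 \<le> c" "\<And>h. \<bar>V h - W h\<bar> \<le> c"
  shows "\<bar>backup R P \<gamma> V h a - backup R P \<gamma> W h a\<bar> \<le> \<gamma> * c"
proof -
  have "backup R P \<gamma> V h a - backup R P \<gamma> W h a =
      (\<Sum>z\<in>UNIV \<times> R. pmf (P h a) z * (\<gamma> * (V (h @ [(a, z)]) - W (h @ [(a, z)]))))"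
    unfolding backup_def sum.cartesian_product case_prod_unfold sum_subtractf[symmetric]
    by (rule sum.cong) (auto simp: algebra_simps)
  also have "\<bar>\<dots>\<bar> \<le> \<gamma> * c"
    by (rule weighted_sum_le)
      (use assms sum_process_le_1[of R "P h a"]
        in \<open>auto simp: sum.cartesian_product case_prod_unfold abs_mult intro!: mult_left_mono\<close>)
  finally show ?thesis .
qed

lemma policy_weighted_bound:
  fixes q :: "'i::finite pmf"
  assumes "\<And>i. \<bar>g i\<bar> \<le> c" "0 \<le> c"
  shows "\<bar>\<Sum>i\<in>UNIV. g i * pmf q i\<bar> \<le> c"
  using weighted_sum_le[of UNIV "pmf q" g c] assms by (simp add: sum_pmf_eq_1 mult.commute)

theorem is_value_unique_existence:
  assumes "finite R" "R \<subseteq> {0..1}" "0 \<le> \<gamma>" "\<gamma> < 1"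
  shows "\<exists>!V. is_value R P \<gamma> \<Phi> V"
proof -
  define T where "T V h = (if h \<in> histories R then \<Sum>a\<in>UNIV. backup R P \<gamma> V h a * pmf (\<Phi> h) a else 0)"
    for V h
  have iff: "is_value R P \<gamma> \<Phi> V \<longleftrightarrow> bounded (range V) \<and> (\<forall>h. V h = T V h)" for V
  proof -
    have "bounded (range V)" if "bounded (V ` histories R)" "\<forall>h. h \<notin> histories R \<longrightarrow> V h = 0"
    proof (rule bounded_subset)
      show "bounded (insert 0 (V ` histories R))" using that by simp
      show "range V \<subseteq> insert 0 (V ` histories R)" using that(2) by auto
    qed
    moreover have "bounded (V ` histories R)" if "bounded (range V)"
      using that by (rule bounded_subset) auto
    ultimately show ?thesis by (auto simp: is_value_def T_def split: if_splits)
  qed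
  show ?thesis unfolding iff
  proof (rule contraction_unique_bounded_fixpoint)
    show "0 \<le> \<gamma>" "\<gamma> < 1" by fact+
    fix h
    have "\<bar>backup R P \<gamma> (\<lambda>_. 0) h a\<bar> \<le> 1" for a
      by (rule backup_bound) (use assms in auto)
    then show "\<bar>T (\<lambda>_. 0) h\<bar> \<le> 1" by (simp add: T_def policy_weighted_bound)
  next
    fix V W :: "('a, 'b) history \<Rightarrow> real" and c h assume VW: "\<And>y. \<bar>V y - W y\<bar> \<le> c"
    then have c: "0 \<le> c" using order_trans[OF abs_ge_zero] by blast
    have "\<bar>(\<Sum>a\<in>UNIV. (backup R P \<gamma> V h a - backup R P \<gamma> W h a) * pmf (\<Phi> h) a)\<bar> \<le> \<gamma> * c"
      by (intro policy_weighted_bound backup_diff_bound) (use assms VW c in auto)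
    then show "\<bar>T V h - T W h\<bar> \<le> \<gamma> * c"
      using assms c by (simp add: T_def left_diff_distrib sum_subtractf)
  qed
qed

corollary is_value_V_value:
  assumes "finite R" "R \<subseteq> {0..1}" "0 \<le> \<gamma>" "\<gamma> < 1"
  shows "is_value R P \<gamma> \<Phi> (V_value R P \<gamma> \<Phi>)"
  unfolding V_value_def by (rule theI'[OF is_value_unique_existence]) (use assms in auto)

lemma summable_on_pmf: "(pmf q) summable_on A"
proof -
  have "finite X \<Longrightarrow> sum (pmf q) X \<le> 1" for X
    by (simp add: measure_pmf.prob_le_1 flip: measure_measure_pmf_finite)
  then show ?thesis
    by (intro nonneg_bdd_above_summable_on bdd_aboveI2[where M = 1]) auto
qed

lemma infsum_pmf_le_1: "(\<Sum>\<^sub>\<infinity>x\<in>A. pmf q x) \<le> 1"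
  by (rule infsum_le_finite_sums[OF summable_on_pmf])
    (simp add: measure_pmf.prob_le_1 flip: measure_measure_pmf_finite)

lemma has_sum_finite_sum:
  fixes g :: "'i \<Rightarrow> 'z \<Rightarrow> real"
  assumes "\<And>i. i \<in> I \<Longrightarrow> (g i has_sum c i) A"
  shows "((\<lambda>z. \<Sum>i\<in>I. g i z) has_sum (\<Sum>i\<in>I. c i)) A"
  using assms by (induction I rule: infinite_finite_induct) (auto intro: has_sum_add)

lemma P_abs_nonneg: "0 \<le> P_abs P f h a s' r"
  by (simp add: P_abs_def sum_nonneg)

lemma sum_P_abs_le_1:
  fixes f :: "('a, 'o::finite) history \<Rightarrow> 's::finite"
  assumes "finite R"
  shows "(\<Sum>s'\<in>UNIV. \<Sum>r\<in>R. P_abs P f h a s' r) \<le> 1"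
proof -
  have "(\<Sum>s'\<in>UNIV. \<Sum>r\<in>R. P_abs P f h a s' r)
      = (\<Sum>r\<in>R. \<Sum>s'\<in>UNIV. \<Sum>x | x \<in> UNIV \<and> f (h @ [(a, x, r)]) = s'. pmf (P h a) (x, r))"
    by (subst sum.swap) (simp add: P_abs_def)
  also have "\<dots> = (\<Sum>r\<in>R. \<Sum>x\<in>UNIV. pmf (P h a) (x, r))"
    by (intro sum.cong refl sum.group) auto
  also have "\<dots> = (\<Sum>x\<in>UNIV. \<Sum>r\<in>R. pmf (P h a) (x, r))" by (rule sum.swap)
  also have "\<dots> \<le> 1" using assms by (rule sum_process_le_1)
  finally show ?thesis .
qed

lemma p_surr_substochastic:
  fixes f :: "('a, 'o::finite) history \<Rightarrow> 's::finite"
  assumes "finite R"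
  shows "0 \<le> p_surr R P f B s b s' r" and "(\<Sum>s'\<in>UNIV. \<Sum>r\<in>R. p_surr R P f B s b s' r) \<le> 1"
proof -
  let ?A = "histories R \<times> UNIV :: (('a, 'o) history \<times> 'a) set"
  let ?g = "\<lambda>s' r z. P_abs P f (fst z) (snd z) s' r * pmf (B s b) z"
  show "0 \<le> p_surr R P f B s b s' r"
    unfolding p_surr_def by (rule infsum_nonneg) (auto simp: P_abs_nonneg)
  have le1: "P_abs P f h a s' r \<le> 1" if "r \<in> R" for h a s' r
  proof -
    have "P_abs P f h a s' r \<le> (\<Sum>r\<in>R. P_abs P f h a s' r)"
      using assms that by (intro member_le_sum) (auto simp: P_abs_nonneg)
    also have "\<dots> \<le> (\<Sum>s'\<in>UNIV. \<Sum>r\<in>R. P_abs P f h a s' r)"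
      by (rule member_le_sum[where f = "\<lambda>s'. \<Sum>r\<in>R. P_abs P f h a s' r"])
        (auto intro!: sum_nonneg P_abs_nonneg)
    also have "\<dots> \<le> 1" by (rule sum_P_abs_le_1[OF assms])
    finally show ?thesis .
  qed
  have summ: "?g s' r summable_on ?A" if "r \<in> R" for s' r
    by (rule summable_on_comparison_test[OF summable_on_pmf[of "B s b"]])
      (use le1[OF that] in \<open>auto simp: P_abs_nonneg mult_left_le_one_le\<close>)
  have hs: "((\<lambda>z. \<Sum>s'\<in>UNIV. \<Sum>r\<in>R. ?g s' r z) has_sum (\<Sum>s'\<in>UNIV. \<Sum>r\<in>R. infsum (?g s' r) ?A)) ?A"
    by (intro has_sum_finite_sum has_sum_infsum summ)
  have "(\<Sum>s'\<in>UNIV. \<Sum>r\<in>R. p_surr R P f B s b s' r) = (\<Sum>s'\<in>UNIV. \<Sum>r\<in>R. infsum (?g s' r) ?A)"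
    by (simp add: p_surr_def case_prod_unfold)
  also have "\<dots> \<le> infsum (pmf (B s b)) ?A"
  proof (rule has_sum_mono[OF hs has_sum_infsum[OF summable_on_pmf]])
    fix z
    have "(\<Sum>s'\<in>UNIV. \<Sum>r\<in>R. ?g s' r z)
        = (\<Sum>s'\<in>UNIV. \<Sum>r\<in>R. P_abs P f (fst z) (snd z) s' r) * pmf (B s b) z"
      by (simp add: sum_distrib_right)
    also have "\<dots> \<le> 1 * pmf (B s b) z"
      by (intro mult_right_mono sum_P_abs_le_1 assms) auto
    finally show "(\<Sum>s'\<in>UNIV. \<Sum>r\<in>R. ?g s' r z) \<le> pmf (B s b) z" by simp
  qed
  also have "\<dots> \<le> 1" by (rule infsum_pmf_le_1)
  finally show "(\<Sum>s'\<in>UNIV. \<Sum>r\<in>R. p_surr R P f B s b s' r) \<le> 1" .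
qed

theorem is_mdp_value_unique_existence:
  fixes p :: "'s::finite \<Rightarrow> 'b::finite \<Rightarrow> 's \<Rightarrow> real \<Rightarrow> real"
  assumes "R \<subseteq> {0..1}" "0 \<le> \<gamma>" "\<gamma> < 1"
    and p: "\<And>s b s' r. 0 \<le> p s b s' r" "\<And>s b. (\<Sum>s'\<in>UNIV. \<Sum>r\<in>R. p s b s' r) \<le> 1"
  shows "\<exists>!v. is_mdp_value R p \<gamma> \<pi> v"
proof -
  define T where "T v s = (\<Sum>b\<in>UNIV. mdp_backup R p \<gamma> v s b * pmf (\<pi> s) b)" for v s
  have iff: "is_mdp_value R p \<gamma> \<pi> v \<longleftrightarrow> bounded (range v) \<and> (\<forall>s. v s = T v s)" for v
    by (simp add: is_mdp_value_def T_def finite_imp_bounded)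
  have bound: "\<bar>\<Sum>z\<in>UNIV \<times> R. p s b (fst z) (snd z) * g z\<bar> \<le> c"
    if "\<And>z. z \<in> UNIV \<times> R \<Longrightarrow> \<bar>g z\<bar> \<le> c" "0 \<le> c" for g c s b
    by (rule weighted_sum_le)
      (use that p in \<open>auto simp: sum.cartesian_product case_prod_unfold\<close>)
  show ?thesis unfolding iff
  proof (rule contraction_unique_bounded_fixpoint)
    show "0 \<le> \<gamma>" "\<gamma> < 1" by fact+
    fix s
    have "\<bar>mdp_backup R p \<gamma> (\<lambda>_. 0) s b\<bar> \<le> 1" for b
      unfolding mdp_backup_def sum.cartesian_product case_prod_unfold
      by (rule bound) (use assms in auto)
    then show "\<bar>T (\<lambda>_. 0) s\<bar> \<le> 1" by (simp add: T_def policy_weighted_bound)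
  next
    fix v w :: "'s \<Rightarrow> real" and c s assume vw: "\<And>y. \<bar>v y - w y\<bar> \<le> c"
    then have c: "0 \<le> c" using order_trans[OF abs_ge_zero] by blast
    have "\<bar>mdp_backup R p \<gamma> v s b - mdp_backup R p \<gamma> w s b\<bar> \<le> \<gamma> * c" for b
    proof -
      have "mdp_backup R p \<gamma> v s b - mdp_backup R p \<gamma> w s b =
          (\<Sum>z\<in>UNIV \<times> R. p s b (fst z) (snd z) * (\<gamma> * (v (fst z) - w (fst z))))"
        unfolding mdp_backup_def sum.cartesian_product case_prod_unfold sum_subtractf[symmetric]
        by (rule sum.cong) (auto simp: algebra_simps)
      also have "\<bar>\<dots>\<bar> \<le> \<gamma> * c"
        by (rule bound) (use assms vw c in \<open>auto simp: abs_mult intro!: mult_left_mono\<close>)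
      finally show ?thesis .
    qed
    then have "\<bar>(\<Sum>b\<in>UNIV. (mdp_backup R p \<gamma> v s b - mdp_backup R p \<gamma> w s b) * pmf (\<pi> s) b)\<bar> \<le> \<gamma> * c"
      by (intro policy_weighted_bound) (use assms c in auto)
    then show "\<bar>T v s - T w s\<bar> \<le> \<gamma> * c"
      by (simp add: T_def left_diff_distrib sum_subtractf)
  qed
qed

corollary is_mdp_value_v_value:
  fixes f :: "('a, 'o::finite) history \<Rightarrow> 's::finite"
    and B :: "'s \<Rightarrow> 'b::finite \<Rightarrow> (('a, 'o) history \<times> 'a) pmf"
  assumes "finite R" "R \<subseteq> {0..1}" "0 \<le> \<gamma>" "\<gamma> < 1"
  shows "is_mdp_value R (p_surr R P f B) \<gamma> \<pi> (v_value R (p_surr R P f B) \<gamma> \<pi>)"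
  unfolding v_value_def
  by (rule theI'[OF is_mdp_value_unique_existence])
    (use assms p_surr_substochastic[OF assms(1), of P f B] in auto)

text \<open>The joint distribution satisfies \<open>B(ha|sb) = B(h|s) B(ab|h) / B(b|s)\<close>.\<close>

lemma joint_of_factorisation:
  assumes "homomorphism R \<psi> f" "stochastic_inverse R \<psi> B" "joint_of B J"
    and h: "h \<in> histories R" "f h = s"
  shows "pmf (B s b) (h, a) = J_h_s J h s * (J_ab_h J a b h / J_b_s J b s)"
proof -
  let ?P = "\<lambda>X. measure_pmf.prob J X"
  have pos: "?P {(h', a', s', b'). s' = s \<and> b' = b} > 0" for s b
    using assms(3) by (simp add: joint_of_def case_prod_unfold)
  have Beq: "pmf (B s b) (h, a) = ?P {(h', a', s', b'). (h' = h \<and> a' = a) \<and> s' = s \<and> b' = b}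
       / ?P {(h', a', s', b'). s' = s \<and> b' = b}" for s b a
    using assms(3) by (simp add: joint_of_def cond_prob_def case_prod_unfold)
  note sb = pos[of s b] and B = Beq[of s b a]
  have supp: "s' = f h" if "(h, a', s', b') \<in> set_pmf J" for a' s' b'
  proof -
    have "0 < pmf J (h, a', s', b')" using that by (simp add: pmf_positive_iff)
    also have "\<dots> = ?P {(h, a', s', b')}" by (simp add: measure_pmf_single)
    also have "{(h, a', s', b')} = {(h'', a'', s'', b''). (h'' = h \<and> a'' = a') \<and> s'' = s' \<and> b'' = b'}"
      by auto
    finally have "pmf (B s' b') (h, a') \<noteq> 0"
      unfolding Beq using pos[of s' b'] by simp
    then have "(h, a') \<in> set_pmf (B s' b')" by (simp add: set_pmf_iff)
    then have "\<psi> (h, a') = (s', b')" using assms(2) by (auto simp: stochastic_inverse_def)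
    then show ?thesis using assms(1) h by (metis homomorphism_def fst_conv)
  qed
  have eq1: "?P {(h', a', s', b'). h' = h \<and> s' = s} = ?P {(h', a', s', b'). h' = h}"
    by (rule measure_pmf.finite_measure_eq_AE) (use supp h in \<open>auto simp: AE_measure_pmf_iff\<close>)
  have eq2: "?P {(h', a', s', b'). (h' = h \<and> a' = a) \<and> s' = s \<and> b' = b}
      = ?P {(h', a', s', b'). (a' = a \<and> b' = b) \<and> h' = h}"
    by (rule measure_pmf.finite_measure_eq_AE) (use supp h in \<open>auto simp: AE_measure_pmf_iff\<close>)
  have sbs: "?P {(h', a', s', b'). b' = b \<and> s' = s} = ?P {(h', a', s', b'). s' = s \<and> b' = b}"
    by (rule arg_cong[where f = ?P]) auto
  have "?P {(h', a', s', b'). s' = s \<and> b' = b} \<le> ?P {(h', a', s', b'). s' = s}"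
    by (rule measure_pmf.finite_measure_mono) auto
  then have s: "?P {(h', a', s', b'). s' = s} > 0" using sb by linarith
  have z: "?P {(h', a', s', b'). (a' = a \<and> b' = b) \<and> h' = h} \<le> ?P {(h', a', s', b'). h' = h}"
    by (rule measure_pmf.finite_measure_mono) auto
  have z': "?P {(h', a', s', b'). (a' = a \<and> b' = b) \<and> h' = h} \<ge> 0" by simp
  define w x y t where "w = ?P {(h', a', s', b'). h' = h}"
    and "x = ?P {(h', a', s', b'). (a' = a \<and> b' = b) \<and> h' = h}"
    and "y = ?P {(h', a', s', b'). s' = s \<and> b' = b}" and "t = ?P {(h', a', s', b'). s' = s}"
  have "x / y = w / t * ((x / w) / (y / t))"
  proof (cases "w = 0")
    case True
    then show ?thesis using z z' unfolding w_def[symmetric] x_def[symmetric] by simp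
  next
    case False
    then show ?thesis using sb s unfolding y_def[symmetric] t_def[symmetric] by (simp add: field_simps)
  qed
  moreover have "J_h_s J h s = w / t" "J_ab_h J a b h = x / w" "J_b_s J b s = y / t"
    using eq1 sbs
    by (simp_all add: J_h_s_def J_ab_h_def J_b_s_def cond_prob_def w_def x_def y_def t_def case_prod_unfold)
  ultimately show ?thesis using B eq2 by (simp add: x_def y_def)
qed

end

theory Submission
  imports Defs
begin

text \<open>
  Average the fixed-point equation of \<open>Q\<^sup>*\<close> over \<open>B\<close> and put
  \<open>U(s) = (\<Sum>b. \<langle>Q\<^sup>*(\<psi>\<^sup>-\<^sup>1(s,b))\<rangle>\<^sub>B \<pi>\<^sup>*(b|s))\<close>.  By the factorisation of \<open>B\<close>, \<open>U(s)\<close> is the mean over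
  \<open>B(h|s)\<close> of \<open>\<Sum>a. Q\<^sup>*(h,a) B\<^sup>\<pi>\<^sup>*(a|hs)\<close>, so the hypotheses place \<open>U(f h)\<close> within \<open>\<delta> = \<epsilon> + \<epsilon>\<^sub>B\<close> of
  \<open>V\<^sup>*(h)\<close>.  The backup of \<open>U\<close> in the surrogate MDP is the \<open>B\<close>-average of the backup of \<open>U \<circ> f\<close> in the
  original process; hence \<open>U\<close> solves the fixed-point equation of \<open>v\<^sup>*\<close> up to \<open>\<gamma>\<delta>\<close>, and
  \<open>|U - v\<^sup>*| \<le> \<gamma>\<delta> / (1 - \<gamma>)\<close>.  This gives the bounds \<open>\<gamma>\<delta> / (1 - \<gamma>)\<close> and \<open>\<delta> / (1 - \<gamma>)\<close>, which are
  smaller than the stated ones.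

  For (ii) the weights \<open>B\<^sup>\<pi>\<^sup>*(a|hs)\<close> need not sum to \<open>1\<close> over \<open>a\<close>, but their totals have mean \<open>1\<close> over
  \<open>B(h|s)\<close>.  If \<open>\<delta> = 0\<close> and \<open>V\<^sup>*(h) > 0\<close>, then \<open>V\<^sup>*(h) = (\<Sum>a. Q\<^sup>*(h,a) B\<^sup>\<pi>\<^sup>*(a|hs))\<close> with
  \<open>Q\<^sup>* \<le> V\<^sup>*\<close> forces every total to be at least \<open>1\<close>, hence equal to \<open>1\<close>, and all actions of positive
  weight are optimal; those actions are mapped to \<open>\<pi>\<^sup>*(s)\<close>.
\<close>

section \<open>Estimates for contractions and weighted infinite sums\<close>

text \<open>The supremum \<open>S\<close> of \<open>g\<close>, clipped below at 0, satisfies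
  \<open>S \<le> d + \<gamma> * S\<close>, which is then solved for \<open>S\<close>. This turns
  every one-step error estimate below into a bound on the fixed points.\<close>

lemma contraction_inequality:
  fixes g :: "'x \<Rightarrow> real"
  assumes \<gamma>: "0 \<le> \<gamma>" "\<gamma> < 1" and d: "0 \<le> d" and bdd: "bdd_above (g ` A)"
    and step: "\<And>c x. 0 \<le> c \<Longrightarrow> (\<And>y. y \<in> A \<Longrightarrow> g y \<le> c) \<Longrightarrow> x \<in> A \<Longrightarrow> g x \<le> d + \<gamma> * c"
    and x: "x \<in> A"
  shows "g x \<le> d / (1 - \<gamma>)"
proof -
  \<comment> \<open>Clipped at 0 because \<open>step\<close> accepts only nonnegative
    bounds.\<close>
  define S where "S = max 0 (SUP x\<in>A. g x)"
  have le: "g y \<le> S" if "y \<in> A" for y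
    using cSUP_upper[OF that bdd] by (simp add: S_def)
  have S: "0 \<le> S" by (simp add: S_def)
  have "(SUP x\<in>A. g x) \<le> d + \<gamma> * S"
    by (rule cSUP_least) (use x step[OF S le] in auto)
  moreover have "0 \<le> d + \<gamma> * S" using d S \<gamma> by simp
  ultimately have "S \<le> d + \<gamma> * S" unfolding S_def by linarith
  then have "S * (1 - \<gamma>) \<le> d" by (simp add: algebra_simps)
  then have "S \<le> d / (1 - \<gamma>)" using \<gamma> by (simp add: pos_le_divide_eq)
  with le[OF x] show ?thesis by linarith
qed

lemma has_sum_pmf:
  assumes "set_pmf q \<subseteq> A"
  shows "(pmf q has_sum 1) A"
proof -
  have "infsum (pmf q) A = 1"
    using infsetsum_pmf_eq_1[OF assms] infsetsum_infsum[OF pmf_abs_summable] by metis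
  then show ?thesis using has_sum_infsum[OF summable_on_pmf] by metis
qed

text \<open>Closeness is required only where the weight is positive, since the hypothesis on the
  lifted policy covers only histories of positive probability.\<close>

lemma weighted_mean_dist_le:
  fixes w g :: "'x \<Rightarrow> real"
  assumes w: "(w has_sum 1) A" "\<And>x. x \<in> A \<Longrightarrow> 0 \<le> w x"
    and g: "((\<lambda>x. w x * g x) has_sum S) A"
    and near: "\<And>x. x \<in> A \<Longrightarrow> 0 < w x \<Longrightarrow> \<bar>g x - c\<bar> \<le> d"
  shows "\<bar>S - c\<bar> \<le> d"
proof -
  have "w x * (c - d) \<le> w x * g x \<and> w x * g x \<le> w x * (c + d)" if "x \<in> A" for x
  proof (cases "w x = 0")
    case False
    then show ?thesis using w(2)[OF that] near[OF that] by (intro conjI mult_left_mono) force+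
  qed simp
  moreover have "((\<lambda>x. w x * k) has_sum 1 * k) A" for k
    by (rule has_sum_cmult_left[OF w(1)])
  ultimately have "1 * (c - d) \<le> S" "S \<le> 1 * (c + d)"
    using has_sum_mono[OF _ g] has_sum_mono[OF g] by blast+
  then show ?thesis by (simp add: abs_le_iff)
qed

lemma summable_on_bounded_times_pmf:
  fixes g :: "'x \<Rightarrow> real"
  assumes "\<And>x. x \<in> A \<Longrightarrow> \<bar>g x\<bar> \<le> M"
  shows "(\<lambda>x. g x * pmf q x) summable_on A"
proof -
  have "(\<lambda>x. norm (g x * pmf q x)) summable_on A"
    by (rule summable_on_comparison_test[OF summable_on_cmult_right[OF summable_on_pmf[of q], of M]])
      (use assms in \<open>auto simp: abs_mult intro!: mult_right_mono\<close>)
  then show ?thesis by (rule abs_summable_summable)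
qed

lemma snoc_in_histories:
  "h \<in> histories R \<Longrightarrow> r \<in> R \<Longrightarrow> h @ [(a, x, r)] \<in> histories R"
  by (simp add: histories_def)

section \<open>Bellman equations and optimality for the original process\<close>

locale discounted =
  fixes R :: "real set" and \<gamma> :: real
  assumes finite_R: "finite R" and R_unit: "R \<subseteq> {0..1}"
    and \<gamma>_nonneg: "0 \<le> \<gamma>" and \<gamma>_less_1: "\<gamma> < 1"
begin

text \<open>One-sided, so that it can serve the comparison principle
  \<open>V_value_dominates\<close>. The total weight is only bounded above by 1, hence
  \<open>0 \<le> c\<close>.\<close>

lemma backup_diff_le:
  fixes V W :: "('a, 'o::finite) history \<Rightarrow> real"
  assumes "h \<in> histories R" "0 \<le> c" "\<And>k. k \<in> histories R \<Longrightarrow> V k - W k \<le> c"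
  shows "backup R P \<gamma> V h a - backup R P \<gamma> W h a \<le> \<gamma> * c"
proof -
  have "backup R P \<gamma> V h a - backup R P \<gamma> W h a
      = (\<Sum>x\<in>UNIV. \<Sum>r\<in>R. pmf (P h a) (x, r) * (\<gamma> * (V (h @ [(a, x, r)]) - W (h @ [(a, x, r)]))))"
    unfolding backup_def sum_subtractf[symmetric]
    by (intro sum.cong refl) (simp add: algebra_simps)
  also have "\<dots> \<le> (\<Sum>x\<in>UNIV. \<Sum>r\<in>R. pmf (P h a) (x, r) * (\<gamma> * c))"
    by (intro sum_mono mult_left_mono) (use assms \<gamma>_nonneg in \<open>auto simp: snoc_in_histories\<close>)
  also have "\<dots> = (\<Sum>x\<in>UNIV. \<Sum>r\<in>R. pmf (P h a) (x, r)) * (\<gamma> * c)"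
    by (simp add: sum_distrib_right)
  also have "\<dots> \<le> 1 * (\<gamma> * c)"
    by (intro mult_right_mono sum_process_le_1 finite_R) (use assms \<gamma>_nonneg in auto)
  finally show ?thesis by simp
qed

lemma backup_dist_le:
  fixes V W :: "('a, 'o::finite) history \<Rightarrow> real"
  assumes "h \<in> histories R" "0 \<le> c" "\<And>k. k \<in> histories R \<Longrightarrow> \<bar>V k - W k\<bar> \<le> c"
  shows "\<bar>backup R P \<gamma> V h a - backup R P \<gamma> W h a\<bar> \<le> \<gamma> * c"
proof -
  have "V k - W k \<le> c" "W k - V k \<le> c" if "k \<in> histories R" for k
    using assms(3)[OF that] by linarith+
  then show ?thesis
    using backup_diff_le[OF assms(1,2), of V W P a] backup_diff_le[OF assms(1,2), of W V P a]
    by (simp add: abs_le_iff)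
qed

lemma mdp_backup_dist_le:
  assumes p: "\<And>s b s' r. 0 \<le> p s b s' r" "\<And>s b. (\<Sum>s'\<in>UNIV. \<Sum>r\<in>R. p s b s' r) \<le> 1"
    and "0 \<le> c" "\<And>s. \<bar>u s - v s\<bar> \<le> c"
  shows "\<bar>mdp_backup R p \<gamma> u s b - mdp_backup R p \<gamma> v s b\<bar> \<le> \<gamma> * c"
proof -
  have "mdp_backup R p \<gamma> u s b - mdp_backup R p \<gamma> v s b
      = (\<Sum>z\<in>UNIV \<times> R. p s b (fst z) (snd z) * (\<gamma> * (u (fst z) - v (fst z))))"
    unfolding mdp_backup_def sum.cartesian_product case_prod_unfold sum_subtractf[symmetric]
    by (rule sum.cong) (auto simp: algebra_simps)
  also have "\<bar>\<dots>\<bar> \<le> \<gamma> * c"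
    by (rule weighted_sum_le)
      (use p assms \<gamma>_nonneg
        in \<open>auto simp: sum.cartesian_product case_prod_unfold abs_mult intro!: mult_left_mono\<close>)
  finally show ?thesis .
qed

lemma V_value_eq:
  "h \<in> histories R \<Longrightarrow>
    V_value R P \<gamma> \<Phi> h = (\<Sum>a\<in>UNIV. Q_value R P \<gamma> \<Phi> h a * pmf (\<Phi> h) a)"
  using is_value_V_value[OF finite_R R_unit \<gamma>_nonneg \<gamma>_less_1, of P \<Phi>]
  by (simp add: is_value_def Q_value_def)

lemma V_value_bounded: "\<exists>M. \<forall>h \<in> histories R. \<bar>V_value R P \<gamma> \<Phi> h\<bar> \<le> M"
proof -
  have "bounded (V_value R P \<gamma> \<Phi> ` histories R)"
    using is_value_V_value[OF finite_R R_unit \<gamma>_nonneg \<gamma>_less_1] by (auto simp: is_value_def)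
  then show ?thesis by (simp add: bounded_iff)
qed

text \<open>Comparison principle: for a subsolution \<open>W\<close> of the evaluation equation, a
  bound \<open>c\<close> on the excess of \<open>W\<close> over the value improves to
  \<open>\<gamma> * c\<close>, so \<open>contraction_inequality\<close> with \<open>d = 0\<close>
  leaves no excess.\<close>

lemma V_value_dominates:
  fixes W :: "('a::finite, 'o::finite) history \<Rightarrow> real"
  assumes W: "bounded (W ` histories R)"
    and sub: "\<And>h. h \<in> histories R \<Longrightarrow> W h \<le> (\<Sum>a\<in>UNIV. backup R P \<gamma> W h a * pmf (\<Phi> h) a)"
    and h: "h \<in> histories R"
  shows "W h \<le> V_value R P \<gamma> \<Phi> h"
proof -
  let ?V = "V_value R P \<gamma> \<Phi>"
  obtain M where M: "\<And>h. h \<in> histories R \<Longrightarrow> \<bar>?V h\<bar> \<le> M"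
    using V_value_bounded[of P \<Phi>] by blast
  obtain N where N: "\<And>h. h \<in> histories R \<Longrightarrow> \<bar>W h\<bar> \<le> N"
    using W by (auto simp: bounded_iff)
  have "W h - ?V h \<le> 0 / (1 - \<gamma>)"
  proof (rule contraction_inequality[OF \<gamma>_nonneg \<gamma>_less_1, where A = "histories R"])
    have "W k - ?V k \<le> N + M" if "k \<in> histories R" for k
      using M[OF that] N[OF that] by linarith
    then show "bdd_above ((\<lambda>h. W h - ?V h) ` histories R)"
      by (intro bdd_aboveI2[where M = "N + M"])
  next
    fix c :: real and k :: "('a, 'o) history"
    assume c: "0 \<le> c" "\<And>y. y \<in> histories R \<Longrightarrow> W y - ?V y \<le> c" and k: "k \<in> histories R"
    have "W k - ?V k \<le> (\<Sum>a\<in>UNIV. (backup R P \<gamma> W k a - backup R P \<gamma> ?V k a) * pmf (\<Phi> k) a)"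
      using sub[OF k] V_value_eq[OF k, of P \<Phi>]
      by (simp add: left_diff_distrib sum_subtractf Q_value_def)
    also have "\<dots> \<le> (\<Sum>a\<in>UNIV. (\<gamma> * c) * pmf (\<Phi> k) a)"
      by (intro sum_mono mult_right_mono backup_diff_le k c) auto
    also have "\<dots> = \<gamma> * c" by (simp add: sum_pmf_eq_1 flip: sum_distrib_left)
    finally show "W k - ?V k \<le> 0 + \<gamma> * c" by simp
  qed (use h in auto)
  then show ?thesis by simp
qed

lemma V_value_nonneg:
  assumes h: "h \<in> histories R"
  shows "0 \<le> V_value R P \<gamma> \<Phi> h"
proof -
  have "0 \<le> backup R P \<gamma> (\<lambda>_. 0) h a" for h a
    unfolding backup_def by (intro sum_nonneg) (use R_unit in auto)
  then show ?thesis
    by (intro V_value_dominates[where W = "\<lambda>_. 0"] h) (auto intro!: sum_nonneg simp: bounded_iff)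
qed

lemma Q_value_nonneg: "h \<in> histories R \<Longrightarrow> 0 \<le> Q_value R P \<gamma> \<Phi> h a"
  unfolding Q_value_def backup_def using R_unit \<gamma>_nonneg
  by (intro sum_nonneg mult_nonneg_nonneg add_nonneg_nonneg V_value_nonneg)
    (auto simp: snoc_in_histories)

text \<open>Policy improvement: the old value function is a subsolution of the evaluation equation
  of \<open>deterministic g\<close>.\<close>

lemma greedy_improves:
  fixes g :: "('a::finite, 'o::finite) history \<Rightarrow> 'a"
  assumes g: "\<And>h. h \<in> histories R \<Longrightarrow> V_value R P \<gamma> \<Phi> h \<le> Q_value R P \<gamma> \<Phi> h (g h)"
    and h: "h \<in> histories R"
  shows "V_value R P \<gamma> \<Phi> h \<le> V_value R P \<gamma> (deterministic g) h"
proof (rule V_value_dominates[OF _ _ h])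
  show "bounded (V_value R P \<gamma> \<Phi> ` histories R)"
    using is_value_V_value[OF finite_R R_unit \<gamma>_nonneg \<gamma>_less_1] by (auto simp: is_value_def)
next
  fix k :: "('a, 'o) history" assume "k \<in> histories R"
  then show "V_value R P \<gamma> \<Phi> k
      \<le> (\<Sum>a\<in>UNIV. backup R P \<gamma> (V_value R P \<gamma> \<Phi>) k a * pmf (deterministic g k) a)"
    using g[of k] by (simp add: deterministic_def Q_value_def pmf_return indicator_def)
qed

text \<open>Optimality is defined by comparing policies, so the Bellman inequality has to be
  derived. The policy \<open>g\<close> that maximises \<open>Q\<close> is at least as good as
  \<Phi>, hence has the same value, and its own evaluation equation yields
  \<open>V h = Q h (g h)\<close>.\<close>

lemma Q_value_le_V_value:
  assumes opt: "optimal_policy R P \<gamma> \<Phi>" and h: "h \<in> histories R"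
  shows "Q_value R P \<gamma> \<Phi> h a \<le> V_value R P \<gamma> \<Phi> h"
proof -
  let ?V = "V_value R P \<gamma> \<Phi>" and ?Q = "Q_value R P \<gamma> \<Phi>"
  have "\<exists>b. \<forall>a. ?Q k a \<le> ?Q k b" for k
  proof -
    have "Max (range (?Q k)) \<in> range (?Q k)" by (rule Max_in) auto
    then obtain b where "?Q k b = Max (range (?Q k))" by force
    then show ?thesis by (metis Max_ge finite_class.finite_UNIV finite_imageI rangeI)
  qed
  then obtain g where g: "\<And>k a. ?Q k a \<le> ?Q k (g k)" by metis
  have "?V k \<le> ?Q k (g k)" if "k \<in> histories R" for k
  proof -
    have "?V k \<le> (\<Sum>a\<in>UNIV. ?Q k (g k) * pmf (\<Phi> k) a)"
      unfolding V_value_eq[OF that] by (intro sum_mono mult_right_mono g) auto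
    also have "\<dots> = ?Q k (g k)" by (simp add: sum_pmf_eq_1 flip: sum_distrib_left)
    finally show ?thesis .
  qed
  \<comment> \<open>One inequality is policy improvement, the other is the optimality of
    \<Phi>.\<close>
  then have eq: "?V k = V_value R P \<gamma> (deterministic g) k" if "k \<in> histories R" for k
    using greedy_improves[of P \<Phi> g k] opt that unfolding optimal_policy_def by (meson order_antisym)
  have "?V h = V_value R P \<gamma> (deterministic g) h" by (rule eq[OF h])
  also have "\<dots> = Q_value R P \<gamma> (deterministic g) h (g h)"
    unfolding V_value_eq[OF h] by (simp add: deterministic_def pmf_return indicator_def)
  also have "\<dots> = ?Q h (g h)"
    unfolding Q_value_def backup_def by (intro sum.cong refl) (simp add: eq snoc_in_histories h)
  finally show ?thesis using g by simp
qed

text \<open>The value is the mean of the action values under \<open>\<Phi> h\<close>; if all of them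
  were strictly smaller, so would be the mean, because some action has positive probability.\<close>

lemma exists_greedy_action:
  assumes "optimal_policy R P \<gamma> \<Phi>" and h: "h \<in> histories R"
  shows "\<exists>a. Q_value R P \<gamma> \<Phi> h a = V_value R P \<gamma> \<Phi> h"
proof (rule ccontr)
  assume "\<nexists>a. Q_value R P \<gamma> \<Phi> h a = V_value R P \<gamma> \<Phi> h"
  then have less: "Q_value R P \<gamma> \<Phi> h a < V_value R P \<gamma> \<Phi> h" for a
    using Q_value_le_V_value[OF assms] by (meson order_le_less)
  have "(\<Sum>a\<in>UNIV. Q_value R P \<gamma> \<Phi> h a * pmf (\<Phi> h) a)
      < (\<Sum>a\<in>UNIV. V_value R P \<gamma> \<Phi> h * pmf (\<Phi> h) a)"
  proof (rule sum_strict_mono_ex1)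
    obtain a where a: "a \<in> set_pmf (\<Phi> h)" using set_pmf_not_empty[of "\<Phi> h"] by blast
    then show "\<exists>a\<in>UNIV. Q_value R P \<gamma> \<Phi> h a * pmf (\<Phi> h) a < V_value R P \<gamma> \<Phi> h * pmf (\<Phi> h) a"
      using less pmf_positive[OF a] by (intro bexI[of _ a]) simp_all
    show "\<forall>a\<in>UNIV. Q_value R P \<gamma> \<Phi> h a * pmf (\<Phi> h) a \<le> V_value R P \<gamma> \<Phi> h * pmf (\<Phi> h) a"
      using less by (intro ballI mult_right_mono) (auto intro: less_imp_le)
  qed simp
  with V_value_eq[OF h, of P \<Phi>] show False by (simp add: sum_pmf_eq_1 flip: sum_distrib_left)
qed

lemma greedy_optimal:
  assumes "optimal_policy R P \<gamma> \<Phi>"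
    and "\<And>h. h \<in> histories R \<Longrightarrow> Q_value R P \<gamma> \<Phi> h (g h) = V_value R P \<gamma> \<Phi> h"
  shows "optimal_policy R P \<gamma> (deterministic g)"
  using assms greedy_improves[of P \<Phi> g] order_trans unfolding optimal_policy_def by (metis order_refl)

end

section \<open>Averages over the stochastic inverse\<close>

locale aggregation = discounted +
  fixes P :: "('a::finite, 'o::finite) history \<Rightarrow> 'a \<Rightarrow> ('o \<times> real) pmf"
    and \<psi> :: "('a, 'o) history \<times> 'a \<Rightarrow> 's::finite \<times> 'b::finite"
    and f :: "('a, 'o) history \<Rightarrow> 's"
    and B :: "'s \<Rightarrow> 'b \<Rightarrow> (('a, 'o) history \<times> 'a) pmf"
    and J :: "(('a, 'o) history \<times> 'a \<times> 's \<times> 'b) pmf"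
  assumes hom: "homomorphism R \<psi> f" and inv: "stochastic_inverse R \<psi> B" and joint: "joint_of B J"
begin

definition cell :: "'s \<Rightarrow> ('a, 'o) history set" where
  "cell s = {h \<in> histories R. f h = s}"

lemma set_pmf_B:
  assumes "(h, a) \<in> set_pmf (B s b)"
  shows "h \<in> cell s \<and> \<psi> (h, a) = (s, b)"
proof -
  have h: "h \<in> histories R" "\<psi> (h, a) = (s, b)"
    using inv assms unfolding stochastic_inverse_def by blast+
  have "fst (\<psi> (h, a)) = f h" using hom h(1) unfolding homomorphism_def by blast
  with h show ?thesis by (simp add: cell_def)
qed

text \<open>The summation range shrinks to \<open>cell s\<close> because \<open>B s b\<close>
  vanishes elsewhere; boundedness of \<open>Q\<close> ensures summability.\<close>

lemma has_sum_B_average: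
  assumes "\<And>h a. h \<in> histories R \<Longrightarrow> \<bar>Q h a\<bar> \<le> M"
  shows "((\<lambda>z. pmf (B s b) z * (case z of (h, a) \<Rightarrow> Q h a)) has_sum B_average R B Q s b) (cell s \<times> UNIV)"
proof -
  have "(\<lambda>z. case_prod Q z * pmf (B s b) z) summable_on histories R \<times> UNIV"
    by (rule summable_on_bounded_times_pmf) (use assms in auto)
  then have "((\<lambda>z. case_prod Q z * pmf (B s b) z) has_sum B_average R B Q s b) (histories R \<times> UNIV)"
    unfolding B_average_def by (simp add: case_prod_unfold has_sum_infsum)
  also have "?this \<longleftrightarrow> ?thesis"
  proof (rule has_sum_cong_neutral)
    fix z :: "('a, 'o) history \<times> 'a" assume "z \<in> histories R \<times> UNIV - cell s \<times> UNIV"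
    then have "fst z \<notin> cell s" by auto
    then have "pmf (B s b) z = 0" using set_pmf_B[of "fst z" "snd z" s b] by (auto simp: set_pmf_iff)
    then show "case_prod Q z * pmf (B s b) z = 0" by simp
  qed (auto simp: cell_def mult.commute)
  finally show ?thesis .
qed

lemma B_average_dist_le:
  assumes Q: "\<And>h a. h \<in> histories R \<Longrightarrow> \<bar>Q h a\<bar> \<le> M" and Q': "\<And>h a. h \<in> histories R \<Longrightarrow> \<bar>Q' h a\<bar> \<le> M'"
    and d: "\<And>h a. h \<in> histories R \<Longrightarrow> \<bar>Q h a - Q' h a\<bar> \<le> d"
  shows "\<bar>B_average R B Q s b - B_average R B Q' s b\<bar> \<le> d"
proof -
  have "((\<lambda>z. pmf (B s b) z * (case z of (h, a) \<Rightarrow> Q h a)) has_sum B_average R B Q s b) (cell s \<times> UNIV)"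
    by (rule has_sum_B_average) (rule Q)
  moreover have "((\<lambda>z. - (pmf (B s b) z * (case z of (h, a) \<Rightarrow> Q' h a))) has_sum - B_average R B Q' s b)
      (cell s \<times> UNIV)"
    by (rule has_sum_uminusI, rule has_sum_B_average) (rule Q')
  ultimately have "((\<lambda>z. pmf (B s b) z * ((case z of (h, a) \<Rightarrow> Q h a) - (case z of (h, a) \<Rightarrow> Q' h a)))
      has_sum (B_average R B Q s b - B_average R B Q' s b)) (cell s \<times> UNIV)"
    unfolding right_diff_distrib unfolding diff_conv_add_uminus
    by (rule has_sum_add)
  \<comment> \<open>The difference is a mean of \<open>Q - Q'\<close> under \<open>B s b\<close>,
    compared with the centre 0.\<close>
  then have "\<bar>(B_average R B Q s b - B_average R B Q' s b) - 0\<bar> \<le> d"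
  proof (rule weighted_mean_dist_le[rotated 2])
    show "(pmf (B s b) has_sum 1) (cell s \<times> UNIV)"
      by (rule has_sum_pmf) (use set_pmf_B in auto)
  qed (use d in \<open>auto simp: cell_def\<close>)
  then show ?thesis by simp
qed

lemma B_average_one: "B_average R B (\<lambda>_ _. 1) s b = 1"
proof -
  have "(pmf (B s b) has_sum B_average R B (\<lambda>_ _. 1) s b) (cell s \<times> UNIV)"
    using has_sum_B_average[of "\<lambda>_ _. 1" 1 s b] by (simp add: case_prod_unfold)
  moreover have "(pmf (B s b) has_sum 1) (cell s \<times> UNIV)"
    by (rule has_sum_pmf) (use set_pmf_B in auto)
  ultimately show ?thesis by (rule has_sum_unique)
qed

text \<open>The sums over \<open>s'\<close> and \<open>r\<close> are finite and may be exchanged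
  with the average. For fixed \<open>h\<close>, \<open>a\<close> and \<open>r\<close>, the
  observations are grouped by the abstract state they lead to, on which \<open>u s'\<close> is
  \<open>u (f (h @ [(a, x, r)]))\<close>.\<close>

lemma mdp_backup_p_surr:
  "mdp_backup R (p_surr R P f B) \<gamma> u s b = B_average R B (backup R P \<gamma> (\<lambda>h. u (f h))) s b"
proof -
  let ?A = "histories R \<times> UNIV :: (('a, 'o) history \<times> 'a) set"
  have P1: "P_abs P f h a s' r \<le> 1" for h a s' r
  proof -
    have "P_abs P f h a s' r = measure (P h a) ((\<lambda>x. (x, r)) ` {x. f (h @ [(a, x, r)]) = s'})"
      unfolding P_abs_def by (subst measure_measure_pmf_finite) (auto simp: sum.reindex inj_on_def)
    then show ?thesis by (simp add: measure_pmf.prob_le_1)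
  qed
  have "((\<lambda>(h, a). P_abs P f h a s' r * pmf (B s b) (h, a)) has_sum p_surr R P f B s b s' r) ?A" for s' r
  proof -
    have "(\<lambda>z. P_abs P f (fst z) (snd z) s' r * pmf (B s b) z) summable_on ?A"
      by (rule summable_on_bounded_times_pmf[where M = 1]) (simp add: P1 abs_of_nonneg[OF P_abs_nonneg])
    then show ?thesis unfolding p_surr_def by (simp add: case_prod_unfold has_sum_infsum)
  qed
  then have "((\<lambda>z. \<Sum>s'\<in>UNIV. \<Sum>r\<in>R. (case z of (h, a) \<Rightarrow> P_abs P f h a s' r * pmf (B s b) (h, a)) * (r + \<gamma> * u s'))
      has_sum mdp_backup R (p_surr R P f B) \<gamma> u s b) ?A"
    unfolding mdp_backup_def by (intro has_sum_finite_sum has_sum_cmult_left)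
  also have "(\<lambda>z. \<Sum>s'\<in>UNIV. \<Sum>r\<in>R. (case z of (h, a) \<Rightarrow> P_abs P f h a s' r * pmf (B s b) (h, a)) * (r + \<gamma> * u s'))
      = (\<lambda>(h, a). backup R P \<gamma> (\<lambda>h. u (f h)) h a * pmf (B s b) (h, a))"
  proof (rule ext)
    fix z :: "('a, 'o) history \<times> 'a"
    obtain h a where z: "z = (h, a)" by (cases z)
    have "(\<Sum>s'\<in>UNIV. \<Sum>r\<in>R. P_abs P f h a s' r * (r + \<gamma> * u s'))
       = (\<Sum>r\<in>R. \<Sum>s'\<in>UNIV. \<Sum>x | x \<in> UNIV \<and> f (h @ [(a, x, r)]) = s'.
            pmf (P h a) (x, r) * (r + \<gamma> * u (f (h @ [(a, x, r)]))))"
      by (subst sum.swap) (simp add: P_abs_def sum_distrib_right)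
    also have "\<dots> = (\<Sum>r\<in>R. \<Sum>x\<in>UNIV. pmf (P h a) (x, r) * (r + \<gamma> * u (f (h @ [(a, x, r)]))))"
      by (intro sum.cong refl sum.group) auto
    also have "\<dots> = backup R P \<gamma> (\<lambda>h. u (f h)) h a"
      unfolding backup_def by (rule sum.swap)
    finally have eq: "(\<Sum>s'\<in>UNIV. \<Sum>r\<in>R. P_abs P f h a s' r * (r + \<gamma> * u s')) = backup R P \<gamma> (\<lambda>h. u (f h)) h a" .
    show "(\<Sum>s'\<in>UNIV. \<Sum>r\<in>R. (case z of (h, a) \<Rightarrow> P_abs P f h a s' r * pmf (B s b) (h, a)) * (r + \<gamma> * u s'))
        = (case z of (h, a) \<Rightarrow> backup R P \<gamma> (\<lambda>h. u (f h)) h a * pmf (B s b) (h, a))"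
      by (simp add: z eq[symmetric] sum_distrib_left sum_distrib_right mult_ac)
  qed
  finally show ?thesis unfolding B_average_def by (simp add: infsumI)
qed

section \<open>Conditioning the joint distribution on the abstract state\<close>

lemma prob_state_pos: "0 < measure_pmf.prob J {(h, a, s', b). s' = s}"
proof -
  have "0 < measure_pmf.prob J {(h, a, s', b'). s' = s \<and> b' = b}" for b
    using joint by (simp add: joint_of_def case_prod_unfold)
  also have "measure_pmf.prob J {(h, a, s', b'). s' = s \<and> b' = b} \<le> measure_pmf.prob J {(h, a, s', b). s' = s}" for b
    by (rule measure_pmf.finite_measure_mono) auto
  finally show ?thesis by blast
qed

text \<open>An atom of \<open>J\<close> gives the conditional \<open>B s b\<close> positive mass at
  \<open>(h, a)\<close>, and the support of \<open>B s b\<close> lies over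
  \<open>cell s\<close>.\<close>

lemma set_pmf_J:
  assumes "(h, a, s, b) \<in> set_pmf J"
  shows "h \<in> cell s"
proof -
  have "0 < pmf J (h, a, s, b)" using assms by (simp add: pmf_positive_iff)
  also have "\<dots> = measure_pmf.prob J {(h', a', s', b'). (h' = h \<and> a' = a) \<and> s' = s \<and> b' = b}"
    by (subst measure_pmf_single[symmetric]) (rule arg_cong[where f = "measure_pmf.prob J"], auto)
  finally have "0 < measure_pmf.prob J {(h', a', s', b'). (h' = h \<and> a' = a) \<and> s' = s \<and> b' = b}" .
  moreover have "0 < measure_pmf.prob J {(h', a', s', b'). s' = s \<and> b' = b}"
    using joint by (simp add: joint_of_def case_prod_unfold)
  moreover have "pmf (B s b) (h, a) = measure_pmf.prob J {(h', a', s', b'). (h' = h \<and> a' = a) \<and> s' = s \<and> b' = b}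
      / measure_pmf.prob J {(h', a', s', b'). s' = s \<and> b' = b}"
    using joint by (simp add: joint_of_def cond_prob_def case_prod_unfold)
  ultimately have "0 < pmf (B s b) (h, a)" by simp
  then show ?thesis using set_pmf_B[of h a s b] by (simp add: set_pmf_iff)
qed

lemma J_h_s_eq:
  assumes "h \<in> cell s"
  shows "J_h_s J h s = J_h J h / measure_pmf.prob J {(h, a, s', b). s' = s}"
proof -
  have "measure_pmf.prob J {(h', a', s', b'). h' = h \<and> s' = s} = measure_pmf.prob J {(h', a', s', b'). h' = h}"
    by (rule measure_pmf.finite_measure_eq_AE)
      (use set_pmf_J assms in \<open>auto simp: AE_measure_pmf_iff cell_def\<close>)
  then show ?thesis by (simp add: J_h_s_def J_h_def cond_prob_def case_prod_unfold)
qed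

text \<open>Connects the positive weights in means over \<open>cell s\<close> with the condition
  \<open>J_h J h > 0\<close> of the theorem.\<close>

lemma J_h_s_pos_iff: "h \<in> cell s \<Longrightarrow> 0 < J_h_s J h s \<longleftrightarrow> 0 < J_h J h"
  using prob_state_pos[of s] by (simp add: J_h_s_eq zero_less_divide_iff)

lemma has_sum_J_h_s: "((\<lambda>h. J_h_s J h s) has_sum 1) (cell s)"
proof -
  let ?E = "{(h, a, s', b). s' = s} :: (('a, 'o) history \<times> 'a \<times> 's \<times> 'b) set"
  \<comment> \<open>The weights \<open>J_h_s J h s\<close> are the point masses of the history
    component of \<open>J\<close> conditioned on the state \<open>s\<close>, which gives total mass
    1.\<close>
  let ?K = "map_pmf fst (cond_pmf J ?E)"
  have ne: "set_pmf J \<inter> ?E \<noteq> {}"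
  proof
    assume "set_pmf J \<inter> ?E = {}"
    then have "measure_pmf.prob J ?E = 0" by (simp add: measure_pmf_zero_iff)
    then show False using prob_state_pos[of s] by simp
  qed
  have "J_h_s J h s = pmf ?K h" for h
  proof -
    have "pmf ?K h = measure_pmf.prob J (?E \<inter> fst -` {h}) / measure_pmf.prob J ?E"
      unfolding pmf_map cond_pmf.rep_eq[OF ne]
      by (subst measure_uniform_measure)
        (use prob_state_pos[of s] in \<open>auto simp: measure_pmf.emeasure_eq_measure\<close>)
    also have "?E \<inter> fst -` {h} = {(h', a', s', b'). h' = h \<and> s' = s}" by auto
    finally show ?thesis by (simp add: J_h_s_def cond_prob_def case_prod_unfold)
  qed
  then have "(\<lambda>h. J_h_s J h s) = pmf ?K" by (rule ext)
  moreover have "(pmf ?K has_sum 1) (cell s)"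
    by (rule has_sum_pmf) (use set_pmf_J in \<open>auto simp: set_cond_pmf[OF ne]\<close>)
  ultimately show ?thesis by (simp only:)
qed

lemma J_h_s_nonneg: "0 \<le> J_h_s J h s"
  by (simp add: J_h_s_def cond_prob_def)

lemma lifted_policy_nonneg: "0 \<le> lifted_policy J \<pi> a h s"
  by (auto simp: lifted_policy_def J_ab_h_def J_b_s_def cond_prob_def intro!: sum_nonneg)

text \<open>Summing over actions first leaves a sum over histories, and
  \<open>joint_of_factorisation\<close> extracts \<open>J_h_s J h s\<close> from each term.
  \<open>Q\<close> is arbitrary so that the constant 1 can be inserted as well.\<close>

lemma has_sum_lifted_policy:
  assumes Q: "\<And>h a. h \<in> histories R \<Longrightarrow> \<bar>Q h a\<bar> \<le> M"
  shows "((\<lambda>h. J_h_s J h s * (\<Sum>a\<in>UNIV. Q h a * lifted_policy J \<pi> a h s))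
    has_sum (\<Sum>b\<in>UNIV. B_average R B Q s b * pmf (\<pi> s) b)) (cell s)"
proof -
  have "((\<lambda>h. \<Sum>a\<in>UNIV. pmf (B s b) (h, a) * Q h a) has_sum B_average R B Q s b) (cell s)" for b
    using has_sum_SigmaD[OF has_sum_B_average[of Q M s b, OF Q] has_sum_finite] by simp
  then have "((\<lambda>h. \<Sum>b\<in>UNIV. (\<Sum>a\<in>UNIV. pmf (B s b) (h, a) * Q h a) * pmf (\<pi> s) b)
      has_sum (\<Sum>b\<in>UNIV. B_average R B Q s b * pmf (\<pi> s) b)) (cell s)"
    by (intro has_sum_finite_sum has_sum_cmult_left)
  also have "?this \<longleftrightarrow> ?thesis"
  proof (rule has_sum_cong)
    fix h assume "h \<in> cell s"
    then have fac: "pmf (B s b) (h, a) = J_h_s J h s * (J_ab_h J a b h / J_b_s J b s)" for a b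
      using joint_of_factorisation[OF hom inv joint] by (simp add: cell_def)
    have "(\<Sum>b\<in>UNIV. (\<Sum>a\<in>UNIV. pmf (B s b) (h, a) * Q h a) * pmf (\<pi> s) b)
        = (\<Sum>a\<in>UNIV. \<Sum>b\<in>UNIV. pmf (B s b) (h, a) * Q h a * pmf (\<pi> s) b)"
      unfolding sum_distrib_right by (rule sum.swap)
    also have "\<dots> = J_h_s J h s * (\<Sum>a\<in>UNIV. Q h a * lifted_policy J \<pi> a h s)"
      unfolding lifted_policy_def sum_distrib_left fac by (intro sum.cong refl) simp
    finally show "(\<Sum>b\<in>UNIV. (\<Sum>a\<in>UNIV. pmf (B s b) (h, a) * Q h a) * pmf (\<pi> s) b)
        = J_h_s J h s * (\<Sum>a\<in>UNIV. Q h a * lifted_policy J \<pi> a h s)" .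
  qed
  finally show ?thesis .
qed

lemma ex_J_h_pos: "\<exists>h \<in> cell s. 0 < J_h J h"
proof (rule ccontr)
  assume "\<not> ?thesis"
  then have "J_h_s J h s = 0" if "h \<in> cell s" for h
    using that J_h_s_pos_iff[OF that] J_h_s_nonneg[of h s] by force
  then have "((\<lambda>h. J_h_s J h s) has_sum 0) (cell s)" by (rule has_sum_0)
  with has_sum_J_h_s[of s] show False using has_sum_unique by fastforce
qed

text \<open>For a deterministic policy only \<open>b = \<pi>d s\<close> contributes, so by the
  factorisation a positive weight places \<open>(h, a)\<close> in the support of
  \<open>B s (\<pi>d s)\<close>.\<close>

lemma lifted_policy_deterministic_pos:
  assumes "h \<in> cell s" "0 < J_h J h" "0 < lifted_policy J (deterministic \<pi>d) a h s"
  shows "\<psi> (h, a) = (s, \<pi>d s)"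
proof -
  have "lifted_policy J (deterministic \<pi>d) a h s
      = (\<Sum>b\<in>UNIV. if b = \<pi>d s then J_ab_h J a b h / J_b_s J b s else 0)"
    unfolding lifted_policy_def by (rule sum.cong) (auto simp: deterministic_def indicator_def)
  then have "lifted_policy J (deterministic \<pi>d) a h s = J_ab_h J a (\<pi>d s) h / J_b_s J (\<pi>d s) s"
    by simp
  then have "0 < J_h_s J h s * (J_ab_h J a (\<pi>d s) h / J_b_s J (\<pi>d s) s)"
    using assms(3) J_h_s_pos_iff[OF assms(1)] assms(2) by (metis mult_pos_pos)
  also have "\<dots> = pmf (B s (\<pi>d s)) (h, a)"
    using joint_of_factorisation[OF hom inv joint] assms(1) by (simp add: cell_def)
  finally show ?thesis using set_pmf_B[of h a s "\<pi>d s"] by (simp add: set_pmf_iff)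
qed

end

section \<open>Error bounds for the surrogate MDP\<close>

locale approximate_aggregation = aggregation R \<gamma> P \<psi> f B J
  for R :: "real set" and \<gamma> :: real
    and P :: "('a::finite, 'o::finite) history \<Rightarrow> 'a \<Rightarrow> ('o \<times> real) pmf"
    and \<psi> :: "('a, 'o) history \<times> 'a \<Rightarrow> 's::finite \<times> 'b::finite"
    and f :: "('a, 'o) history \<Rightarrow> 's"
    and B :: "'s \<Rightarrow> 'b \<Rightarrow> (('a, 'o) history \<times> 'a) pmf"
    and J :: "(('a, 'o) history \<times> 'a \<times> 's \<times> 'b) pmf" +
  fixes \<Phi> :: "('a, 'o) history \<Rightarrow> 'a pmf" and \<pi> :: "'s \<Rightarrow> 'b pmf" and \<epsilon> \<epsilon>\<^sub>B :: real
  assumes optimal: "optimal_policy R P \<gamma> \<Phi>"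
    and V_near: "\<And>h h'. h \<in> histories R \<Longrightarrow> h' \<in> histories R \<Longrightarrow> f h = f h' \<Longrightarrow>
           \<bar>V_value R P \<gamma> \<Phi> h - V_value R P \<gamma> \<Phi> h'\<bar> \<le> \<epsilon>"
    and lifted_near: "\<And>h s. h \<in> histories R \<Longrightarrow> J_h J h > 0 \<Longrightarrow> f h = s \<Longrightarrow>
           \<bar>(\<Sum>a\<in>UNIV. Q_value R P \<gamma> \<Phi> h a * lifted_policy J \<pi> a h s) - V_value R P \<gamma> \<Phi> h\<bar> \<le> \<epsilon>\<^sub>B"
begin

abbreviation "V \<equiv> V_value R P \<gamma> \<Phi>"
abbreviation "Q \<equiv> Q_value R P \<gamma> \<Phi>"
abbreviation "p \<equiv> p_surr R P f B"
abbreviation "v \<equiv> v_value R p \<gamma> \<pi>"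

definition U :: "'s \<Rightarrow> real" where
  "U s = (\<Sum>b\<in>UNIV. B_average R B Q s b * pmf (\<pi> s) b)"

lemma \<epsilon>_nonneg: "0 \<le> \<epsilon>"
  using V_near[of "[]" "[]"] by (simp add: histories_def)

text \<open>\<open>lifted_near\<close> must be applied to some history of positive probability;
  \<open>ex_J_h_pos\<close> supplies one.\<close>

lemma \<epsilon>\<^sub>B_nonneg: "0 \<le> \<epsilon>\<^sub>B"
  using ex_J_h_pos lifted_near order_trans[OF abs_ge_zero] unfolding cell_def by blast

lemma Q_bounded: "\<exists>M. \<forall>h \<in> histories R. \<forall>a. \<bar>Q h a\<bar> \<le> M"
proof -
  obtain M where M: "\<And>h. h \<in> histories R \<Longrightarrow> \<bar>V h\<bar> \<le> M"
    using V_value_bounded[of P \<Phi>] by blast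
  have "\<bar>Q h a\<bar> \<le> M" if "h \<in> histories R" for h a
    using M[OF that] Q_value_nonneg[OF that, of P \<Phi> a] Q_value_le_V_value[OF optimal that, of a] by linarith
  then show ?thesis by blast
qed

text \<open>Each term of the mean is within \<open>\<epsilon>\<^sub>B\<close> of \<open>V k\<close>,
  which is within \<epsilon> of \<open>V h\<close> because \<open>k\<close> lies in the same
  cell.\<close>

lemma U_near_V:
  assumes "h \<in> histories R"
  shows "\<bar>U (f h) - V h\<bar> \<le> \<epsilon> + \<epsilon>\<^sub>B"
proof -
  obtain M where M: "\<And>h a. h \<in> histories R \<Longrightarrow> \<bar>Q h a\<bar> \<le> M" using Q_bounded by blast
  show ?thesis
  proof (rule weighted_mean_dist_le[OF has_sum_J_h_s J_h_s_nonneg])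
    show "((\<lambda>k. J_h_s J k (f h) * (\<Sum>a\<in>UNIV. Q k a * lifted_policy J \<pi> a k (f h))) has_sum U (f h)) (cell (f h))"
      unfolding U_def by (rule has_sum_lifted_policy) (rule M)
    fix k assume k: "k \<in> cell (f h)" "0 < J_h_s J k (f h)"
    show "\<bar>(\<Sum>a\<in>UNIV. Q k a * lifted_policy J \<pi> a k (f h)) - V h\<bar> \<le> \<epsilon> + \<epsilon>\<^sub>B"
      using lifted_near[of k "f h"] V_near[of k h] k assms J_h_s_pos_iff[OF k(1)] by (simp add: cell_def)
  qed
qed

text \<open>Both terms are \<open>B\<close>-averages of backups, one of \<open>V\<close> and one of
  \<open>U\<close> composed with \<open>f\<close>; a backup shrinks the distance from
  \<open>U_near_V\<close> by the factor \<gamma>.\<close>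

lemma B_average_near_backup_U: "\<bar>B_average R B Q s b - mdp_backup R p \<gamma> U s b\<bar> \<le> \<gamma> * (\<epsilon> + \<epsilon>\<^sub>B)"
proof -
  obtain M where M: "\<And>h a. h \<in> histories R \<Longrightarrow> \<bar>Q h a\<bar> \<le> M" using Q_bounded by blast
  have d: "\<bar>Q h a - backup R P \<gamma> (\<lambda>h. U (f h)) h a\<bar> \<le> \<gamma> * (\<epsilon> + \<epsilon>\<^sub>B)" if "h \<in> histories R" for h a
    unfolding Q_value_def
  proof (rule backup_dist_le[OF that])
    show "\<bar>V k - U (f k)\<bar> \<le> \<epsilon> + \<epsilon>\<^sub>B" if "k \<in> histories R" for k
      using U_near_V[OF that] by (simp add: abs_minus_commute)
  qed (use \<epsilon>_nonneg \<epsilon>\<^sub>B_nonneg in simp)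
  \<comment> \<open>The size of this bound is immaterial; it only secures summability of the second
    average.\<close>
  have M': "\<bar>backup R P \<gamma> (\<lambda>h. U (f h)) h a\<bar> \<le> M + \<gamma> * (\<epsilon> + \<epsilon>\<^sub>B)" if "h \<in> histories R" for h a
    using d[OF that, of a] M[OF that, of a] by linarith
  show ?thesis unfolding mdp_backup_p_surr
    by (rule B_average_dist_le) (fact M M' d)+
qed

lemma U_near_v: "\<bar>U s - v s\<bar> \<le> \<gamma> * (\<epsilon> + \<epsilon>\<^sub>B) / (1 - \<gamma>)"
proof (rule contraction_inequality[OF \<gamma>_nonneg \<gamma>_less_1, where g = "\<lambda>s. \<bar>U s - v s\<bar>" and A = UNIV])
  show "0 \<le> \<gamma> * (\<epsilon> + \<epsilon>\<^sub>B)" using \<gamma>_nonneg \<epsilon>_nonneg \<epsilon>\<^sub>B_nonneg by simp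
  fix c s assume c: "0 \<le> c" "\<And>y. y \<in> UNIV \<Longrightarrow> \<bar>U y - v y\<bar> \<le> c"
  have v: "v s = (\<Sum>b\<in>UNIV. mdp_backup R p \<gamma> v s b * pmf (\<pi> s) b)"
    using is_mdp_value_v_value[OF finite_R R_unit \<gamma>_nonneg \<gamma>_less_1, of P f B \<pi>] by (simp add: is_mdp_value_def)
  have "\<bar>\<Sum>b\<in>UNIV. (B_average R B Q s b - mdp_backup R p \<gamma> v s b) * pmf (\<pi> s) b\<bar> \<le> \<gamma> * (\<epsilon> + \<epsilon>\<^sub>B) + \<gamma> * c"
  proof (rule policy_weighted_bound)
    fix b
    have "\<bar>mdp_backup R p \<gamma> U s b - mdp_backup R p \<gamma> v s b\<bar> \<le> \<gamma> * c"
      by (rule mdp_backup_dist_le) (use p_surr_substochastic[OF finite_R, of P f B] c in auto)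
    then show "\<bar>B_average R B Q s b - mdp_backup R p \<gamma> v s b\<bar> \<le> \<gamma> * (\<epsilon> + \<epsilon>\<^sub>B) + \<gamma> * c"
      using B_average_near_backup_U[of s b] by linarith
  qed (use \<gamma>_nonneg \<epsilon>_nonneg \<epsilon>\<^sub>B_nonneg c in simp)
  then show "\<bar>U s - v s\<bar> \<le> \<gamma> * (\<epsilon> + \<epsilon>\<^sub>B) + \<gamma> * c"
    by (subst v) (simp add: U_def left_diff_distrib sum_subtractf)
qed auto

lemma V_near_v:
  assumes "h \<in> histories R"
  shows "\<bar>V h - v (f h)\<bar> \<le> (\<epsilon> + \<epsilon>\<^sub>B) / (1 - \<gamma>)"
proof -
  have "\<bar>V h - v (f h)\<bar> \<le> (\<epsilon> + \<epsilon>\<^sub>B) + \<gamma> * (\<epsilon> + \<epsilon>\<^sub>B) / (1 - \<gamma>)"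
    using U_near_V[OF assms] U_near_v[of "f h"] by linarith
  also have "\<dots> = (\<epsilon> + \<epsilon>\<^sub>B) / (1 - \<gamma>)" using \<gamma>_less_1 by (simp add: field_simps)
  finally show ?thesis .
qed

lemma B_average_near_q: "\<bar>B_average R B Q s b - q_value R p \<gamma> \<pi> s b\<bar> \<le> \<gamma> * (\<epsilon> + \<epsilon>\<^sub>B) / (1 - \<gamma>)"
proof -
  have "\<bar>mdp_backup R p \<gamma> U s b - q_value R p \<gamma> \<pi> s b\<bar> \<le> \<gamma> * (\<gamma> * (\<epsilon> + \<epsilon>\<^sub>B) / (1 - \<gamma>))"
    unfolding q_value_def
    by (rule mdp_backup_dist_le[OF _ _ _ U_near_v])
      (use p_surr_substochastic[OF finite_R, of P f B] \<gamma>_nonneg \<gamma>_less_1 \<epsilon>_nonneg \<epsilon>\<^sub>B_nonneg in auto)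
  then have "\<bar>B_average R B Q s b - q_value R p \<gamma> \<pi> s b\<bar>
      \<le> \<gamma> * (\<epsilon> + \<epsilon>\<^sub>B) + \<gamma> * (\<gamma> * (\<epsilon> + \<epsilon>\<^sub>B) / (1 - \<gamma>))"
    using B_average_near_backup_U[of s b] by linarith
  also have "\<dots> = \<gamma> * (\<epsilon> + \<epsilon>\<^sub>B) / (1 - \<gamma>)" using \<gamma>_less_1 by (simp add: field_simps)
  finally show ?thesis .
qed

section \<open>Optimal actions in the exact case\<close>

text \<open>If \<open>V h = 0\<close>, all action values at \<open>h\<close> vanish and the weights
  are unconstrained there, so \<open>cond\<close> has to supply an action mapped to
  \<open>\<pi>d s\<close>; any such action is optimal.\<close>

lemma exact_optimal_action:
  assumes exact: "\<epsilon> + \<epsilon>\<^sub>B = 0" and \<pi>: "\<pi> = deterministic \<pi>d"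
    and h: "h \<in> cell s" "0 < J_h J h" and cond: "V h \<noteq> 0 \<or> (\<exists>a. \<psi> (h, a) = (s, \<pi>d s))"
  shows "\<exists>a. \<psi> (h, a) = (s, \<pi>d s) \<and> Q h a = V h"
proof (cases "V h = 0")
  case True
  have hR: "h \<in> histories R" using h by (simp add: cell_def)
  have "Q h a = V h" for a
    using Q_value_nonneg[OF hR, of P \<Phi> a] Q_value_le_V_value[OF optimal hR, of a] True by linarith
  with cond True show ?thesis by blast
next
  case False
  let ?w = "\<lambda>k. J_h_s J k s" and ?l = "\<lambda>k a. lifted_policy J \<pi> a k s"
  have 0: "\<epsilon> = 0" "\<epsilon>\<^sub>B = 0" using exact \<epsilon>_nonneg \<epsilon>\<^sub>B_nonneg by linarith+
  have hR: "h \<in> histories R" using h by (simp add: cell_def)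
  have V_pos: "0 < V h" using False V_value_nonneg[OF hR, of P \<Phi>] by simp
  have V_eq: "(\<Sum>a\<in>UNIV. Q k a * ?l k a) = V h" if "k \<in> cell s" "0 < J_h J k" for k
    using that h lifted_near[of k s] V_near[of k h] 0 by (simp add: cell_def)
  have Q_le: "Q k a \<le> V h" if "k \<in> cell s" for k a
    using that h Q_value_le_V_value[OF optimal, of k a] V_near[of k h] 0 by (simp add: cell_def)
  have ge1: "1 \<le> (\<Sum>a\<in>UNIV. ?l k a)" if "k \<in> cell s" "0 < J_h J k" for k
  proof -
    have "(\<Sum>a\<in>UNIV. Q k a * ?l k a) \<le> (\<Sum>a\<in>UNIV. V h * ?l k a)"
      by (intro sum_mono mult_right_mono Q_le that lifted_policy_nonneg)
    with V_eq[OF that] have "V h * 1 \<le> V h * (\<Sum>a\<in>UNIV. ?l k a)" by (simp add: sum_distrib_left)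
    then show ?thesis using V_pos by (simp only: mult_le_cancel_left_pos)
  qed
  \<comment> \<open>The averaging identity for the constant 1: the weight totals have mean
    1.\<close>
  have total: "((\<lambda>k. ?w k * (\<Sum>a\<in>UNIV. ?l k a)) has_sum 1) (cell s)"
    using has_sum_lifted_policy[of "\<lambda>_ _. 1" 1 s \<pi>] by (simp add: B_average_one sum_pmf_eq_1)
  have le: "?w k \<le> ?w k * (\<Sum>a\<in>UNIV. ?l k a)" if "k \<in> cell s" for k
  proof (cases "0 < J_h J k")
    case True
    then show ?thesis using mult_left_mono[OF ge1[OF that True] J_h_s_nonneg[of k s]] by simp
  next
    case False
    then have "?w k = 0" using J_h_s_pos_iff[OF that] J_h_s_nonneg[of k s] by linarith
    then show ?thesis by simp
  qed
  \<comment> \<open>Two termwise ordered families with the same sum 1 cannot differ at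
    \<open>h\<close>.\<close>
  have "\<not> ?w h < ?w h * (\<Sum>a\<in>UNIV. ?l h a)"
    using has_sum_strict_mono[OF has_sum_J_h_s total le h(1)] by blast
  with le[OF h(1)] J_h_s_pos_iff[OF h(1)] h(2) have one: "(\<Sum>a\<in>UNIV. ?l h a) = 1" by auto
  then have "\<exists>a. ?l h a \<noteq> 0" by (metis sum.neutral zero_neq_one)
  then obtain a where a: "0 < ?l h a"
    using lifted_policy_nonneg[of \<pi> _ h s] by (metis order_le_less)
  \<comment> \<open>With total weight 1 the nonnegative gaps \<open>V h - Q h a\<close> average to
    0, so they vanish wherever the weight is positive.\<close>
  have "(\<Sum>a\<in>UNIV. (V h - Q h a) * ?l h a) = 0"
    using V_eq[OF h] one by (simp add: left_diff_distrib sum_subtractf flip: sum_distrib_left)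
  moreover have "0 \<le> (V h - Q h a) * ?l h a" for a
    using Q_le[OF h(1)] lifted_policy_nonneg by simp
  ultimately have "(V h - Q h a) * ?l h a = 0"
    by (simp add: sum_nonneg_eq_0_iff)
  with a have "Q h a = V h" by simp
  moreover have "\<psi> (h, a) = (s, \<pi>d s)"
    using lifted_policy_deterministic_pos[OF h] a \<pi> by simp
  ultimately show ?thesis by blast
qed

end

text \<open>Several actions may be optimal at a history, so (ii) is split: some deterministic
  optimal policy is mapped to \<open>\<pi>d\<close>, and every one is wherever its action is the
  only maximiser.\<close>

theorem theorem10:
  fixes R :: "real set" and \<gamma> \<epsilon> \<epsilon>\<^sub>B :: real
    and P :: "('a::finite, 'o::finite) history \<Rightarrow> 'a \<Rightarrow> ('o \<times> real) pmf"
    and \<psi> :: "('a, 'o) history \<times> 'a \<Rightarrow> 's::finite \<times> 'b::finite"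
    and f :: "('a, 'o) history \<Rightarrow> 's"
    and B :: "'s \<Rightarrow> 'b \<Rightarrow> (('a, 'o) history \<times> 'a) pmf"
    and J :: "(('a, 'o) history \<times> 'a \<times> 's \<times> 'b) pmf"
    and \<Phi>s :: "('a, 'o) history \<Rightarrow> 'a pmf" and \<pi>s :: "'s \<Rightarrow> 'b pmf"
  assumes "finite R" and "R \<subseteq> {0..1}" and "0 \<le> \<gamma>" and "\<gamma> < 1"
    and "process R P"
    and "homomorphism R \<psi> f"
    and "stochastic_inverse R \<psi> B" and "joint_of B J"
    and "p = p_surr R P f B"
    and "optimal_policy R P \<gamma> \<Phi>s" and "Vs = V_value R P \<gamma> \<Phi>s" and "Qs = Q_value R P \<gamma> \<Phi>s"
    and "optimal_mdp_policy R p \<gamma> \<pi>s" and "vs = v_value R p \<gamma> \<pi>s" and "qs = q_value R p \<gamma> \<pi>s"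
    and "\<And>h h'. h \<in> histories R \<Longrightarrow> h' \<in> histories R \<Longrightarrow> f h = f h' \<Longrightarrow> \<bar>Vs h - Vs h'\<bar> \<le> \<epsilon>"
    and "\<And>h s. h \<in> histories R \<Longrightarrow> J_h J h > 0 \<Longrightarrow> f h = s \<Longrightarrow>
           \<bar>(\<Sum>a\<in>UNIV. Qs h a * lifted_policy J \<pi>s a h s) - Vs h\<bar> \<le> \<epsilon>\<^sub>B"
  shows "(\<forall>h \<in> histories R. \<forall>a s b. \<psi> (h, a) = (s, b) \<longrightarrow>
            \<bar>B_average R B Qs s b - qs s b\<bar> \<le> 3 * \<gamma> * (\<epsilon> + \<epsilon>\<^sub>B) / (1 - \<gamma>)\<^sup>2 \<and>
            \<bar>Vs h - vs s\<bar> \<le> 3 * (\<epsilon> + \<epsilon>\<^sub>B) / (1 - \<gamma>)\<^sup>2) \<and>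
         (\<forall>\<pi>d. \<epsilon> + \<epsilon>\<^sub>B = 0 \<and> \<pi>s = deterministic \<pi>d \<longrightarrow>
            (\<exists>\<Phi>d. optimal_policy R P \<gamma> (deterministic \<Phi>d) \<and>
              (\<forall>h \<in> histories R. \<forall>s. f h = s \<and> J_h J h > 0 \<and>
                  (Vs h \<noteq> 0 \<or> (\<exists>a. \<psi> (h, a) = (s, \<pi>d s))) \<longrightarrow>
                \<psi> (h, \<Phi>d h) = (s, \<pi>d s))) \<and>
            (\<forall>\<Phi>d. optimal_policy R P \<gamma> (deterministic \<Phi>d) \<longrightarrow>
              (\<forall>h \<in> histories R. \<forall>s. f h = s \<and> J_h J h > 0 \<and>
                  (Vs h \<noteq> 0 \<or> (\<exists>a. \<psi> (h, a) = (s, \<pi>d s))) \<and>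
                  (\<forall>a. Qs h a = Vs h \<longrightarrow> a = \<Phi>d h) \<longrightarrow>
                \<psi> (h, \<Phi>d h) = (s, \<pi>d s))))"
proof -
  interpret A: approximate_aggregation R \<gamma> P \<psi> f B J \<Phi>s \<pi>s \<epsilon> \<epsilon>\<^sub>B
    by unfold_locales (use assms in simp_all)
  note eqs = \<open>p = _\<close> \<open>Vs = _\<close> \<open>Qs = _\<close> \<open>vs = _\<close> \<open>qs = _\<close>
  \<comment> \<open>Passes from the sharper bounds to the stated ones, using
    \<open>1 - \<gamma> \<le> 3\<close>.\<close>
  have weaken: "x / (1 - \<gamma>) \<le> 3 * x / (1 - \<gamma>)\<^sup>2" if "0 \<le> x" for x
  proof -
    have "x * (1 - \<gamma>) \<le> x * 3" using that A.\<gamma>_nonneg by (intro mult_left_mono) auto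
    then have "x * (1 - \<gamma>) / (1 - \<gamma>)\<^sup>2 \<le> x * 3 / (1 - \<gamma>)\<^sup>2" by (rule divide_right_mono) simp
    then show ?thesis using A.\<gamma>_less_1 by (simp add: power2_eq_square mult.commute)
  qed
  have i: "\<bar>B_average R B Qs s b - qs s b\<bar> \<le> 3 * \<gamma> * (\<epsilon> + \<epsilon>\<^sub>B) / (1 - \<gamma>)\<^sup>2 \<and>
      \<bar>Vs h - vs s\<bar> \<le> 3 * (\<epsilon> + \<epsilon>\<^sub>B) / (1 - \<gamma>)\<^sup>2"
    if "h \<in> histories R" "\<psi> (h, a) = (s, b)" for h a s b
  proof -
    have "f h = s" using A.hom that by (metis homomorphism_def fst_conv)
    then show ?thesis
      using A.B_average_near_q[of s b] A.V_near_v[OF that(1)] weaken[of "\<epsilon> + \<epsilon>\<^sub>B"]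
        weaken[of "\<gamma> * (\<epsilon> + \<epsilon>\<^sub>B)"] A.\<gamma>_nonneg A.\<epsilon>_nonneg A.\<epsilon>\<^sub>B_nonneg
      by (simp add: eqs mult.assoc)
  qed
  have act: "\<exists>a. \<psi> (h, a) = (f h, \<pi>d (f h)) \<and> Qs h a = Vs h"
    if "\<epsilon> + \<epsilon>\<^sub>B = 0" "\<pi>s = deterministic \<pi>d" "h \<in> histories R" "J_h J h > 0"
      "Vs h \<noteq> 0 \<or> (\<exists>a. \<psi> (h, a) = (f h, \<pi>d (f h)))" for \<pi>d h
    using A.exact_optimal_action[of \<pi>d h "f h"] that by (simp add: eqs A.cell_def)
  have ii: "\<exists>\<Phi>d. optimal_policy R P \<gamma> (deterministic \<Phi>d) \<and>
      (\<forall>h \<in> histories R. \<forall>s. f h = s \<and> J_h J h > 0 \<and> (Vs h \<noteq> 0 \<or> (\<exists>a. \<psi> (h, a) = (s, \<pi>d s))) \<longrightarrow>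
        \<psi> (h, \<Phi>d h) = (s, \<pi>d s))"
    if ex: "\<epsilon> + \<epsilon>\<^sub>B = 0" "\<pi>s = deterministic \<pi>d" for \<pi>d
  proof -
    \<comment> \<open>The chosen action must be a maximiser at every history for the policy to be
      optimal; where \<open>act\<close> does not apply, any greedy action is taken.\<close>
    have "\<exists>a. Qs h a = Vs h \<and> (J_h J h > 0 \<and> (Vs h \<noteq> 0 \<or> (\<exists>a. \<psi> (h, a) = (f h, \<pi>d (f h)))) \<longrightarrow>
        \<psi> (h, a) = (f h, \<pi>d (f h)))" if "h \<in> histories R" for h
      using act[OF ex that] A.exists_greedy_action[OF A.optimal that] unfolding eqs by blast
    then obtain \<Phi>d where \<Phi>d: "\<And>h. h \<in> histories R \<Longrightarrow> Qs h (\<Phi>d h) = Vs h \<and>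
        (J_h J h > 0 \<and> (Vs h \<noteq> 0 \<or> (\<exists>a. \<psi> (h, a) = (f h, \<pi>d (f h)))) \<longrightarrow>
          \<psi> (h, \<Phi>d h) = (f h, \<pi>d (f h)))"
      by metis
    have "optimal_policy R P \<gamma> (deterministic \<Phi>d)"
      by (rule A.greedy_optimal[OF A.optimal]) (use \<Phi>d in \<open>simp add: eqs\<close>)
    with \<Phi>d show ?thesis by blast
  qed
  have iii: "\<psi> (h, \<Phi>d h) = (s, \<pi>d s)"
    if "\<epsilon> + \<epsilon>\<^sub>B = 0" "\<pi>s = deterministic \<pi>d" "h \<in> histories R"
      "f h = s \<and> J_h J h > 0 \<and> (Vs h \<noteq> 0 \<or> (\<exists>a. \<psi> (h, a) = (s, \<pi>d s))) \<and>
        (\<forall>a. Qs h a = Vs h \<longrightarrow> a = \<Phi>d h)" for \<pi>d \<Phi>d h s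
    using act[of \<pi>d h] that by blast
  show ?thesis using i ii iii by blast
qed

end
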